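(* Let $q,t$ be commuting indeterminates and let the seeds be $$s_\ell=\ell+q\quad(\ell\ge0),\qquad t_\ell=\tfrac12\,\ell(\ell-1+2t)\quad(\ell\ge1).$$ Then for all $n,k\ge0$ the entry $a_{n,k}$ of the associated Catalan matrix is the generating function of cycle-up-down partial permutations with respect to $\mathsf{fix}$ and $\mathsf{cyc}_{\ge2}$: $$a_{n,k}=\sum_{\pi\in\mathfrak{U}_{n,k}}q^{\mathsf{fix}(\pi)}t^{\mathsf{cyc}_{\ge2}(\pi)}.$$
   Context: Catalan matrix: given seeds $(s_0,s_1,\ldots)$ and $(t_1,t_2,\ldots)$ with all $t_i\ne0$, the matrix $(a_{n,k})_{n,k\ge0}$ is defined by $a_{0,0}=1$, $a_{0,k}=0$ for $k>0$, and $a_{n,k}=a_{n-1,k-1}+s_ka_{n-1,k}+t_{k+1}a_{n-1,k+1}$ for $n\ge1$, with $a_{n,-1}=0$. A partial permutation of order $n$ is an $n\times n$ $(0,1)$-matrix $\pi=(\pi_{i,j})$ with at most one $1$ in each row and each column; $\mathfrak{P}_{n,k}$ is the set of those with exactly $k$ zero rows (for $n=0$ there is only the empty matrix, lying in $\mathfrak{P}_{0,0}$). Regard $\pi$ as the partial map $i\mapsto j$ whenever $\pi_{i,j}=1$. It decomposes $\{1,\ldots,n\}$ into full cycles (closed cycles $(a_1a_2\cdots a_r)$ with $a_1\mapsto a_2\mapsto\cdots\mapsto a_r\mapsto a_1$, including fixed points) and partial cycles $(a_1a_2\cdots a_r\mathsf{X})$, where $a_1\mapsto a_2\mapsto\cdots\mapsto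 a_r$, $a_1$ has no preimage (column $a_1$ is zero) and $a_r$ has no image (row $a_r$ is zero). An element of $\mathfrak{P}_{n,k}$ has exactly $k$ partial cycles. $\mathsf{fix}(\pi)$ is the number of $i$ with $\pi_{i,i}=1$, and $\mathsf{cyc}_{\ge2}(\pi)$ is the number of full cycles of length at least $2$. $\pi\in\mathfrak{P}_{n,k}$ is cycle-up-down if every full cycle $(a_1a_2\cdots a_r)$, written with $a_1$ its smallest element, satisfies $a_1<a_2>a_3<\cdots$ (alternating up to $a_r$), and every partial cycle $(a_1a_2\cdots a_r\mathsf{X})$ satisfies $a_1<a_2>a_3<\cdots$ (alternating up to $a_r$; here $a_1$ need not be the smallest element). $\mathfrak{U}_{n,k}$ is the set of cycle-up-down elements of $\mathfrak{P}_{n,k}$. *)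

theory Defs
  imports "Jordan_Normal_Form.Matrix" "HOL-Computational_Algebra.Polynomial"
begin

text \<open>The seed \<open>t\<close> is only used at positive indices; the value \<open>t 0\<close> is irrelevant.\<close>

fun catalan_matrix :: "(nat \<Rightarrow> 'a::comm_ring_1) \<Rightarrow> (nat \<Rightarrow> 'a) \<Rightarrow> nat \<Rightarrow> nat \<Rightarrow> 'a" where
  "catalan_matrix s t 0 k = (if k = 0 then 1 else 0)"
| "catalan_matrix s t (Suc n) k =
     (if k = 0 then 0 else catalan_matrix s t n (k - 1))
     + s k * catalan_matrix s t n k
     + t (k + 1) * catalan_matrix s t n (k + 1)"

text \<open>The polynomial ring in two commuting indeterminates over the rationals is
  \<open>rat poly poly\<close>: the inner variable is \<open>q\<close>, the outer one is \<open>t\<close>.\<close>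

definition q_var :: "rat poly poly" where
  "q_var = [:[:0, 1:]:]"

definition t_var :: "rat poly poly" where
  "t_var = [:0, 1:]"

definition s_seed :: "nat \<Rightarrow> rat poly poly" where
  "s_seed l = of_nat l + q_var"

definition t_seed :: "nat \<Rightarrow> rat poly poly" where
  "t_seed l = [:[:1/2:]:] * (of_nat l * (of_nat l - 1 + 2 * t_var))"

text \<open>Catalan matrices are considered for nonvanishing seeds \<open>t\<close> only.\<close>

lemma t_seed_nonzero:
  assumes "l \<ge> 1"
  shows "t_seed l \<noteq> 0"
proof -
  have "coeff (of_nat l - 1 + 2 * t_var) 1 = (2 :: rat poly)"
    by (simp add: t_var_def of_nat_poly numeral_poly)
  then have "of_nat l - 1 + 2 * t_var \<noteq> 0"
    by (metis coeff_0 zero_neq_numeral)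
  with assms show ?thesis
    unfolding t_seed_def by simp
qed

text \<open>Rows and columns of matrices are indexed from 0 here, so that the index \<open>i\<close> stands for
  the element \<open>i + 1\<close> of \<open>{1..n}\<close>. The shift preserves the order of the elements.\<close>

definition partial_perms :: "nat \<Rightarrow> nat \<Rightarrow> nat mat set" where
  "partial_perms n k = {P \<in> carrier_mat n n.
     (\<forall>i<n. \<forall>j<n. P $$ (i, j) \<in> {0, 1}) \<and>
     (\<forall>i<n. card {j. j < n \<and> P $$ (i, j) = 1} \<le> 1) \<and>
     (\<forall>j<n. card {i. i < n \<and> P $$ (i, j) = 1} \<le> 1) \<and>
     card {i. i < n \<and> row P i = 0\<^sub>v n} = k}"

definition maps_to :: "nat mat \<Rightarrow> nat \<Rightarrow> nat \<Rightarrow> bool" where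
  "maps_to P i j \<longleftrightarrow> i < dim_row P \<and> j < dim_col P \<and> P $$ (i, j) = 1"

text \<open>A full cycle is represented by its unique word \<open>a\<^sub>1 a\<^sub>2 \<dots> a\<^sub>r\<close> starting with the smallest
  element.\<close>

definition full_cycles :: "nat mat \<Rightarrow> nat list set" where
  "full_cycles P = {w. w \<noteq> [] \<and> distinct w \<and> hd w = Min (set w) \<and>
     (\<forall>i. Suc i < length w \<longrightarrow> maps_to P (w ! i) (w ! Suc i)) \<and>
     maps_to P (last w) (hd w)}"

definition partial_cycles :: "nat mat \<Rightarrow> nat list set" where
  "partial_cycles P = {w. w \<noteq> [] \<and> distinct w \<and>
     hd w < dim_col P \<and> col P (hd w) = 0\<^sub>v (dim_row P) \<and>
     (\<forall>i. Suc i < length w \<longrightarrow> maps_to P (w ! i) (w ! Suc i)) \<and>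
     last w < dim_row P \<and> row P (last w) = 0\<^sub>v (dim_col P)}"

definition up_down :: "nat list \<Rightarrow> bool" where
  "up_down w \<longleftrightarrow> (\<forall>i. Suc i < length w \<longrightarrow>
     (if even i then w ! i < w ! Suc i else w ! i > w ! Suc i))"

definition cycle_up_down :: "nat \<Rightarrow> nat \<Rightarrow> nat mat set" where
  "cycle_up_down n k = {P \<in> partial_perms n k.
     (\<forall>w \<in> full_cycles P. up_down w) \<and> (\<forall>w \<in> partial_cycles P. up_down w)}"

definition fix_count :: "nat mat \<Rightarrow> nat" where
  "fix_count P = card {i. i < dim_row P \<and> P $$ (i, i) = 1}"

definition cyc_ge2 :: "nat mat \<Rightarrow> nat" where
  "cyc_ge2 P = card {w \<in> full_cycles P. length w \<ge> 2}"

lemma finite_partial_perms: "finite (partial_perms n k)"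
proof (rule finite_subset)
  let ?F = "({..<n} \<times> {..<n}) \<rightarrow>\<^sub>E {0, 1 :: nat}"
  show "partial_perms n k \<subseteq> mat n n ` ?F"
  proof
    fix P assume P: "P \<in> partial_perms n k"
    let ?f = "restrict (\<lambda>ij. P $$ ij) ({..<n} \<times> {..<n})"
    have "\<forall>i<n. \<forall>j<n. P $$ (i, j) \<in> {0, 1}" using P by (simp add: partial_perms_def)
    then have "?f \<in> ?F" by (intro PiE_I) (auto simp del: One_nat_def)
    moreover have "P = mat n n ?f"
      using P by (intro eq_matI) (auto simp: partial_perms_def)
    ultimately show "P \<in> mat n n ` ?F" by blast
  qed
  show "finite (mat n n ` ?F)" by (intro finite_imageI finite_PiE) auto
qed

lemma finite_cycle_up_down: "finite (cycle_up_down n k)"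
  by (rule finite_subset[OF _ finite_partial_perms[of n k]]) (auto simp: cycle_up_down_def)

end

theory Submission
  imports
    Defs
    "HOL-Computational_Algebra.Formal_Power_Series"
    "HOL-Combinatorics.Multiset_Permutations"
begin

text \<open>
  A partial permutation is the set of its full and partial cycles, so the generating function of
  all cycle-up-down ones is governed by the numbers \<open>E\<^sub>n\<close> of alternating words of length \<open>n\<close>:
  there are \<open>E\<^sub>n\<close> admissible partial cycles and \<open>E\<^bsub>n-1\<^esub>\<close> admissible full cycles on \<open>n\<close> elements.
  If \<open>A\<^sub>k(x)\<close> is the exponential generating function for \<open>k\<close> partial cycles and
  \<open>G = (\<Sum>n\<ge>1. E\<^sub>n x\<^sup>n / n!)\<close>, removing the cycle of one element gives
  \<open>A\<^sub>k' = (q + t G) A\<^sub>k + G' A\<^bsub>k-1\<^esub>\<close>. Uniqueness for linear differential equations yields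
  \<open>(k + 1) A\<^bsub>k+1\<^esub> = G A\<^sub>k\<close>, and Andre's identity \<open>2 G' = 2 + 2 G + G\<^sup>2\<close>
  turns the equation for \<open>A\<^sub>k'\<close> into the recurrence of the Catalan matrix.
\<close>

section \<open>The differential equation and the Catalan recurrence\<close>

no_notation vec_index (infixl "$" 100)
unbundle fps_syntax

text \<open>The seeds come out of Andre's identity: writing G' = 1 + G + G^2/2, the three summands
  turn G' A_(k-1) into A_(k-1), k A_k and k(k+1)/2 A_(k+1), because a factor G shifts the index at
  the price of a linear factor, and t G A_k adds t(k+1) A_(k+1). This yields k + q on the diagonal
  and (k+1)(k+2t)/2 next to it. Multiplying by G amounts to marking one partial cycle, so A_k = A_0
  G^k / k!. Uniqueness proves this without a closed form of A_0, which would involve a power with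
  the indeterminate exponent t. Full cycles have the index n-1 because their word starts with its
  minimum, so that a free word on one letter fewer follows; partial cycles may start anywhere. On
  the combinatorial side, removing a cycle leaves an arbitrary ground set. Sets of words survive
  this step, matrices of fixed shape do not, so the counting is done on sets of words and the
  matrices enter through a bijection. A third indeterminate marks partial cycles, which treats all k
  at once.\<close>

definition rat_const :: "rat \<Rightarrow> rat poly poly" where
  "rat_const r = [:[:r:]:]"

lemma rat_const_mult: "rat_const (a * b) = rat_const a * rat_const b"
  by (simp add: rat_const_def one_pCons)

lemma rat_const_of_nat: "rat_const (of_nat n) = of_nat n"
  by (simp add: rat_const_def of_nat_poly)

lemma rat_const_1: "rat_const 1 = 1"
  by (simp add: rat_const_def one_pCons)

text \<open>The coefficient ring is not a field, so the denominators \<open>n!\<close> enter as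
  constant polynomials.\<close>

definition egf :: "(nat \<Rightarrow> rat poly poly) \<Rightarrow> rat poly poly fps" where
  "egf f = Abs_fps (\<lambda>n. rat_const (1 / fact n) * f n)"

lemma egf_nth: "egf f $ n = rat_const (1 / fact n) * f n"
  by (simp add: egf_def)

lemma egf_nth_0 [simp]: "egf f $ 0 = f 0"
  by (simp add: egf_nth rat_const_1)

lemma egf_zero: "egf (\<lambda>n. 0) = 0"
  by (rule fps_ext) (simp add: egf_nth)

lemma egf_add: "egf f + egf g = egf (\<lambda>n. f n + g n)"
  by (rule fps_ext) (simp add: egf_nth algebra_simps)

lemma egf_const_mult: "fps_const c * egf f = egf (\<lambda>n. c * f n)"
  by (rule fps_ext) (simp add: egf_nth algebra_simps)

lemma fps_const_eq_egf: "fps_const c = egf (\<lambda>n. if n = 0 then c else 0)"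
  by (rule fps_ext) (simp add: egf_nth rat_const_1)

text \<open>The two reciprocal factorials combine to \<open>1 / fact n\<close> times a binomial
  coefficient, so products are binomial convolutions: the shape of every counting recurrence
  below.\<close>

lemma egf_mult:
  "egf f * egf g = egf (\<lambda>n. \<Sum>j\<le>n. of_nat (n choose j) * (f j * g (n - j)))"
proof (rule fps_ext)
  fix n
  have "rat_const (1 / fact j) * f j * (rat_const (1 / fact (n - j)) * g (n - j)) =
      rat_const (1 / fact n) * (of_nat (n choose j) * (f j * g (n - j)))" if "j \<le> n" for j
  proof -
    have "(1 / fact j) * (1 / fact (n - j)) = (1 / fact n) * (of_nat (n choose j) :: rat)"
      using that by (simp add: binomial_fact)
    then have "rat_const (1 / fact j) * rat_const (1 / fact (n - j)) =
        rat_const (1 / fact n) * of_nat (n choose j)"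
      by (metis rat_const_mult rat_const_of_nat)
    then show ?thesis
      by (metis (no_types, lifting) mult.assoc mult.left_commute)
  qed
  then have "(\<Sum>j\<le>n. rat_const (1 / fact j) * f j * (rat_const (1 / fact (n - j)) * g (n - j))) =
      (\<Sum>j\<le>n. rat_const (1 / fact n) * (of_nat (n choose j) * (f j * g (n - j))))"
    by (intro sum.cong) auto
  then show "(egf f * egf g) $ n =
      egf (\<lambda>n. \<Sum>j\<le>n. of_nat (n choose j) * (f j * g (n - j))) $ n"
    by (simp add: egf_nth fps_mult_nth sum_distrib_left atLeast0AtMost)
qed

lemma fps_deriv_egf: "fps_deriv (egf f) = egf (\<lambda>n. f (Suc n))"
proof (rule fps_ext)
  fix n
  have "of_nat (Suc n) * (1 / fact (Suc n)) = (1 / fact n :: rat)"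
    by (simp del: of_nat_Suc)
  then have "of_nat (Suc n) * rat_const (1 / fact (Suc n)) = rat_const (1 / fact n)"
    by (metis rat_const_mult rat_const_of_nat)
  then show "fps_deriv (egf f) $ n = egf (\<lambda>n. f (Suc n)) $ n"
    by (simp add: egf_nth flip: mult.assoc del: of_nat_Suc fact_Suc)
qed

lemma egf_inject: "egf f = egf g \<Longrightarrow> f = g"
proof
  fix n
  assume "egf f = egf g"
  then have "rat_const (1 / fact n) * f n = rat_const (1 / fact n) * g n"
    by (metis egf_nth)
  moreover have "rat_const (1 / fact n) \<noteq> 0"
    by (simp add: rat_const_def one_pCons)
  ultimately show "f n = g n" by simp
qed

text \<open>Coefficient \<open>m\<close> of the equation expresses \<open>(m + 1)\<close> times the
  next coefficient of \<open>D\<close> by earlier ones, so zero propagates; characteristic 0 and the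
  absence of zero divisors allow \<open>m + 1\<close> to be cancelled.\<close>

lemma fps_linear_ode_unique:
  fixes D :: "'a :: {idom, ring_char_0} fps"
  assumes D: "fps_deriv D = \<Psi> * D" and "D $ 0 = 0"
  shows "D = 0"
proof (rule fps_ext)
  fix n
  show "D $ n = 0 $ n"
  proof (induction n rule: less_induct)
    case (less n)
    show ?case
    proof (cases n)
      case 0
      then show ?thesis using assms by simp
    next
      case (Suc m)
      have "of_nat (Suc m) * D $ Suc m = (\<Psi> * D) $ m"
        using arg_cong[OF D, of "\<lambda>x. x $ m"] by simp
      also have "\<dots> = 0"
        using less Suc by (auto simp: fps_mult_nth intro!: sum.neutral)
      finally show ?thesis using Suc by (simp del: of_nat_Suc)
    qed
  qed
qed

section \<open>From the two counting recurrences to the Catalan matrix\<close>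

lemma double_t_seed: "2 * t_seed l = of_nat l * (of_nat l - 1 + 2 * t_var)"
proof -
  have "2 * [:[:1/2:]:] = (1 :: rat poly poly)"
    by (simp add: numeral_poly one_pCons)
  then show ?thesis
    by (simp only: t_seed_def mult_1 flip: mult.assoc)
qed

text \<open>Purely algebraic: counting enters only through \<open>E_Suc\<close> and
  \<open>a_Suc\<close>. In \<open>a_Suc\<close>, \<open>j\<close> is the number of companions of a
  distinguished element in its cycle; the first summand stands for a full cycle, the second for a
  partial one.\<close>

lemma catalan_matrix_eqI:
  fixes E :: "nat \<Rightarrow> rat poly poly" and a :: "nat \<Rightarrow> nat \<Rightarrow> rat poly poly"
  assumes E0: "E 0 = 1"
    and E_Suc: "\<And>n. 2 * E (Suc n) =
      (if n = 0 then 1 else 0) + (\<Sum>j\<le>n. of_nat (n choose j) * (E j * E (n - j)))"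
    and a0: "\<And>k. a 0 k = (if k = 0 then 1 else 0)"
    and a_Suc: "\<And>n k. a (Suc n) k = (\<Sum>j\<le>n. of_nat (n choose j) *
      ((if j = 0 then q_var else t_var * E j) * a (n - j) k +
       (if k = 0 then 0 else E (Suc j) * a (n - j) (k - 1))))"
  shows "a n k = catalan_matrix s_seed t_seed n k"
proof -
  define S where "S = egf E"
  \<comment> \<open>Cycles are nonempty, so the empty word is taken out. The resulting zero constant
    term also supplies the initial condition for uniqueness below.\<close>
  define G where "G = S - 1"
  define H where "H = fps_const q_var + fps_const t_var * G"
  define A where "A k = egf (\<lambda>n. a n k)" for k
  define A' where "A' k = (if k = 0 then 0 else A (k - 1))" for k
  have G': "2 * fps_deriv G = 2 + 2 * G + G * G"
  proof -
    have "fps_const 2 * fps_deriv S = fps_const 1 + S * S"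
      unfolding S_def fps_deriv_egf egf_mult egf_const_mult fps_const_eq_egf[of 1] egf_add E_Suc ..
    then have "2 * fps_deriv S = 1 + S * S"
      by (simp add: numeral_fps_const)
    then show ?thesis by (simp add: G_def algebra_simps)
  qed
  have H: "H = egf (\<lambda>j. if j = 0 then q_var else t_var * E j)"
    by (rule fps_ext) (simp add: H_def G_def S_def egf_nth rat_const_1 E0)
  have A_deriv: "fps_deriv (A k) = H * A k + fps_deriv G * A' k" for k
  proof -
    have "fps_deriv (A k) = H * A k +
        egf (\<lambda>n. \<Sum>j\<le>n. of_nat (n choose j) *
          (E (Suc j) * (if k = 0 then 0 else a (n - j) (k - 1))))"
      unfolding A_def fps_deriv_egf H egf_mult egf_add
      by (rule arg_cong[where f = egf])
         (auto simp: a_Suc algebra_simps sum.distrib intro!: ext sum.cong)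
    also have "egf (\<lambda>n. \<Sum>j\<le>n. of_nat (n choose j) *
          (E (Suc j) * (if k = 0 then 0 else a (n - j) (k - 1)))) =
        fps_deriv G * A' k"
      by (cases k) (simp_all add: G_def S_def A'_def A_def fps_deriv_egf egf_mult egf_zero)
    finally show ?thesis .
  qed
  have GA: "of_nat (Suc k) * A (Suc k) = G * A k" for k
  proof -
    \<comment> \<open>\<open>D k\<close> is the defect of the claim. Differentiation leaves
      \<open>H * D k\<close> and, for positive \<open>k\<close>, also
      \<open>fps_deriv G * D (k - 1)\<close>, which vanishes by induction; what remains is a
      homogeneous equation.\<close>
    define D where "D k = of_nat (Suc k) * A (Suc k) - G * A k" for k
    have "D k = 0"
    proof (induction k)
      case 0
      have "fps_deriv (D 0) = H * D 0"
        unfolding D_def by (simp add: A_deriv A'_def algebra_simps)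
      then show ?case
        by (rule fps_linear_ode_unique) (simp add: D_def A_def G_def S_def a0 E0)
    next
      case (Suc k)
      have "fps_deriv (D (Suc k)) = H * D (Suc k) + fps_deriv G * D k"
        unfolding D_def by (simp add: A_deriv A'_def algebra_simps)
      with Suc have "fps_deriv (D (Suc k)) = H * D (Suc k)" by simp
      then show ?case
        by (rule fps_linear_ode_unique) (simp add: D_def A_def G_def S_def a0 E0)
    qed
    then show ?thesis by (simp add: D_def)
  qed
  have GA': "G * A' k = of_nat k * A k" for k
    by (cases k) (simp_all add: A'_def GA[symmetric])
  have rec: "a (Suc n) k = (if k = 0 then 0 else a n (k - 1)) + s_seed k * a n k
      + t_seed (k + 1) * a n (k + 1)" for n k
  proof -
    \<comment> \<open>Doubling allows the identity for \<open>2 * fps_deriv G\<close> to be used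
      without fractions.\<close>
    have "2 * fps_deriv (A k) = 2 * H * A k + (2 * fps_deriv G) * A' k"
      by (simp add: A_deriv algebra_simps)
    also have "\<dots> = 2 * fps_const q_var * A k + 2 * fps_const t_var * (G * A k)
        + 2 * A' k + 2 * (G * A' k) + G * (G * A' k)"
      unfolding G' by (simp add: H_def algebra_simps)
    \<comment> \<open>Each factor \<open>G\<close> is traded for an index shift; for
      \<open>G * (G * A' k)\<close> this happens twice and produces
      \<open>k * (k + 1)\<close>.\<close>
    also have "\<dots> = 2 * fps_const q_var * A k + 2 * fps_const t_var * (of_nat (Suc k) * A (Suc k))
        + 2 * A' k + 2 * (of_nat k * A k) + of_nat k * (of_nat (Suc k) * A (Suc k))"
      unfolding GA' mult.left_commute[of G "of_nat k"] GA[symmetric] ..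
    also have "\<dots> = 2 * A' k + 2 * fps_const (s_seed k) * A k
        + fps_const (of_nat (Suc k) * (of_nat k + 2 * t_var)) * A (Suc k)"
      by (simp add: s_seed_def algebra_simps fps_of_nat flip: fps_const_add fps_const_mult numeral_fps_const)
    \<comment> \<open>The contributions of \<open>t_var * G\<close> and of \<open>G * G\<close> to
      \<open>A (Suc k)\<close> add up to exactly twice the seed.\<close>
    also have "of_nat (Suc k) * (of_nat k + 2 * t_var) = 2 * t_seed (Suc k)"
      by (simp add: double_t_seed)
    finally have "fps_const 2 * fps_deriv (A k) = fps_const 2 * A' k
        + fps_const (2 * s_seed k) * A k + fps_const (2 * t_seed (Suc k)) * A (Suc k)"
      by (simp add: fps_numeral_fps_const flip: fps_const_mult numeral_fps_const)
    moreover have "A' k = egf (\<lambda>n. if k = 0 then 0 else a n (k - 1))"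
      by (auto simp: A'_def A_def fps_eq_iff egf_nth)
    ultimately have "egf (\<lambda>n. 2 * a (Suc n) k) = egf (\<lambda>n. 2 * (if k = 0 then 0 else a n (k - 1))
        + 2 * s_seed k * a n k + 2 * t_seed (Suc k) * a n (Suc k))"
      by (simp add: A_def fps_deriv_egf egf_const_mult egf_add)
    from fun_cong[OF egf_inject[OF this], of n]
    have "2 * a (Suc n) k = 2 * ((if k = 0 then 0 else a n (k - 1)) + s_seed k * a n k
      + t_seed (k + 1) * a n (k + 1))" by (simp add: algebra_simps)
    then show ?thesis by (metis mult_left_cancel zero_neq_numeral)
  qed
  show ?thesis
    by (induction n arbitrary: k) (simp_all add: a0 rec del: of_nat_Suc)
qed

section \<open>Alternating words\<close>

text \<open>Swapping the relation on the tail replaces bookkeeping of index parity, and lets up-down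
  and down-up words be instances of one notion.\<close>

fun alternating :: "('a \<Rightarrow> 'a \<Rightarrow> bool) \<Rightarrow> 'a list \<Rightarrow> bool" where
  "alternating R [] \<longleftrightarrow> True"
| "alternating R [x] \<longleftrightarrow> True"
| "alternating R (x # y # w) \<longleftrightarrow> R x y \<and> alternating (\<lambda>a b. R b a) (y # w)"

lemma alternating_conv_nth:
  "alternating R w \<longleftrightarrow>
    (\<forall>i. Suc i < length w \<longrightarrow> (if even i then R (w ! i) (w ! Suc i) else R (w ! Suc i) (w ! i)))"
proof (induction R w rule: alternating.induct)
  case (3 R x y w)
  have *: "(\<forall>i. P i) \<longleftrightarrow> P 0 \<and> (\<forall>i. P (Suc i))" for P :: "nat \<Rightarrow> bool"
    by (metis nat.exhaust)
  show ?case unfolding alternating.simps 3 by (subst (2) *) auto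
qed simp_all

lemma up_down_eq_alternating: "up_down w \<longleftrightarrow> alternating (<) w"
  by (auto simp: up_down_def alternating_conv_nth)

text \<open>A maximal letter can only sit at a peak. Peaks are at odd positions if the word starts
  with an ascent and at even ones if it starts with a descent; the exception is the one-letter word.
  After a peak comes a valley, so \<open>w2\<close> starts with an ascent in both cases. The two
  claims need each other, since each letter removed from \<open>w1\<close> swaps the
  relation.\<close>

lemma alternating_append_maximum:
  assumes "\<And>x. x \<in> set w1 \<union> set w2 \<Longrightarrow> R x m \<and> \<not> R m x"
  shows "(alternating R (w1 @ m # w2) \<longleftrightarrow>
      alternating R w1 \<and> alternating R w2 \<and> (odd (length w1) \<or> w1 = [] \<and> w2 = [])) \<and>
    (alternating (\<lambda>a b. R b a) (w1 @ m # w2) \<longleftrightarrow>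
      alternating (\<lambda>a b. R b a) w1 \<and> alternating R w2 \<and> even (length w1))"
  using assms
proof (induction w1)
  case Nil
  then show ?case by (cases w2) auto
next
  case (Cons x w)
  have "R x m" "\<not> R m x" using Cons.prems by auto
  moreover have "(alternating R (w @ m # w2) \<longleftrightarrow>
      alternating R w \<and> alternating R w2 \<and> (odd (length w) \<or> w = [] \<and> w2 = [])) \<and>
    (alternating (\<lambda>a b. R b a) (w @ m # w2) \<longleftrightarrow>
      alternating (\<lambda>a b. R b a) w \<and> alternating R w2 \<and> even (length w))"
    using Cons by auto
  ultimately show ?case by (cases w) auto
qed

text \<open>The letter \<open>m\<close> occurs once, so the cut is unique. \<open>B\<close> collects
  the letters to its left; once it is fixed, the two sides are chosen independently.\<close>

lemma card_permutations_split:
  assumes "finite S" and "m \<notin> S"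
    and Q: "\<And>w1 w2. set w1 \<union> set w2 = S \<Longrightarrow> Q (w1 @ m # w2) \<longleftrightarrow> Q1 w1 \<and> Q2 w2"
  shows "card {w \<in> permutations_of_set (insert m S). Q w} =
    (\<Sum>B\<in>Pow S. card {w \<in> permutations_of_set B. Q1 w} *
      card {w \<in> permutations_of_set (S - B). Q2 w})"
proof -
  let ?A = "\<lambda>B. {w \<in> permutations_of_set B. Q1 w} \<times> {w \<in> permutations_of_set (S - B). Q2 w}"
  have "bij_betw (\<lambda>(B, w1, w2). w1 @ m # w2) (SIGMA B:Pow S. ?A B)
      {w \<in> permutations_of_set (insert m S). Q w}" (is "bij_betw ?f ?X ?Y")
    unfolding bij_betw_def
  proof
    show "inj_on ?f ?X"
    proof (rule inj_onI)
      fix p p' assume "p \<in> ?X" "p' \<in> ?X" and eq: "?f p = ?f p'"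
      moreover obtain B w1 w2 B' w1' w2' where p: "p = (B, w1, w2)" "p' = (B', w1', w2')"
        by (metis surj_pair)
      ultimately have "set w1 = B" "set w1' = B'"
          "m \<notin> set w1" "m \<notin> set w1'" "m \<notin> set w2" "m \<notin> set w2'"
        using \<open>m \<notin> S\<close> by (auto simp: permutations_of_set_def)
      with eq show "p = p'"
        by (auto simp: p append_Cons_eq_iff)
    qed
    show "?f ` ?X = ?Y"
    proof (intro equalityI subsetI)
      fix w assume "w \<in> ?f ` ?X"
      then obtain B w1 w2 where w: "w = w1 @ m # w2" and "(w1, w2) \<in> ?A B" "B \<subseteq> S"
        by auto
      then have "set w1 = B" "set w2 = S - B" "distinct w1" "distinct w2" "Q1 w1" "Q2 w2"
        by (auto simp: permutations_of_set_def)
      with \<open>B \<subseteq> S\<close> \<open>m \<notin> S\<close> Q[of w1 w2] show "w \<in> ?Y"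
        by (auto simp: w permutations_of_set_def)
    next
      fix w assume w: "w \<in> ?Y"
      then have "m \<in> set w" by (auto simp: permutations_of_set_def)
      then obtain w1 w2 where eq: "w = w1 @ m # w2" by (meson split_list)
      have "set w1 \<union> set w2 = S" "distinct w1" "distinct w2" "set w1 \<inter> set w2 = {}"
        using w \<open>m \<notin> S\<close> by (auto simp: eq permutations_of_set_def)
      moreover have "Q1 w1 \<and> Q2 w2"
        using w Q[of w1 w2] calculation(1) by (simp add: eq)
      ultimately have "(set w1, w1, w2) \<in> ?X"
        by (auto simp: permutations_of_set_def)
      then show "w \<in> ?f ` ?X" by (rule rev_image_eqI) (simp add: eq)
    qed
  qed
  then have "card ?Y = card ?X" by (simp add: bij_betw_same_card)
  also have "\<dots> = (\<Sum>B\<in>Pow S. card (?A B))"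
    using \<open>finite S\<close> by (intro card_SigmaI) auto
  finally show ?thesis by (simp add: card_cartesian_product)
qed

section \<open>Alternating words on a given finite set\<close>

definition alt_count :: "('a \<Rightarrow> 'a \<Rightarrow> bool) \<Rightarrow> 'a set \<Rightarrow> nat" where
  "alt_count R V = card {w \<in> permutations_of_set V. alternating R w}"

lemma alt_count_empty [simp]: "alt_count R {} = 1"
proof -
  have "{w \<in> permutations_of_set {}. alternating R w} = {[]}" by auto
  then show ?thesis by (simp add: alt_count_def)
qed

lemma alt_count_singleton [simp]: "alt_count R {x} = 1"
proof -
  have "{w \<in> permutations_of_set {x}. alternating R w} = {[x]}" by auto
  then show ?thesis by (simp add: alt_count_def)
qed

lemma card_alternating_parity:
  "card {w \<in> permutations_of_set B. alternating R w \<and> P (length w)} =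
    (if P (card B) then alt_count R B else 0)"
proof -
  have "length w = card B" if "w \<in> permutations_of_set B" for w
    using that by (auto simp: permutations_of_set_def distinct_card)
  then have "{w \<in> permutations_of_set B. alternating R w \<and> P (length w)} =
      (if P (card B) then {w \<in> permutations_of_set B. alternating R w} else {})"
    by auto
  then show ?thesis by (simp add: alt_count_def)
qed

text \<open>Cut at the maximum: the parity of the left part is forced by the orientation.
  Nonemptiness of \<open>S\<close> in the first claim excludes the one-letter word, whose maximum is
  at position 0 although it counts as up-down.\<close>

lemma
  fixes S :: "'a set"
  assumes "finite S" and max: "\<And>x. x \<in> S \<Longrightarrow> R x m \<and> \<not> R m x" and "m \<notin> S"
  shows alt_count_insert_maximum:
      "S \<noteq> {} \<Longrightarrow> alt_count R (insert m S) =
        (\<Sum>B\<in>Pow S. (if odd (card B) then alt_count R B else 0) * alt_count R (S - B))"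
    and alt_count_converse_insert_maximum:
      "alt_count (\<lambda>a b. R b a) (insert m S) =
        (\<Sum>B\<in>Pow S. (if even (card B) then alt_count (\<lambda>a b. R b a) B else 0) * alt_count R (S - B))"
proof -
  assume "S \<noteq> {}"
  then have "alternating R (w1 @ m # w2) \<longleftrightarrow>
      (alternating R w1 \<and> odd (length w1)) \<and> alternating R w2" if "set w1 \<union> set w2 = S" for w1 w2
    using alternating_append_maximum[of w1 w2 R m] max that by auto
  from card_permutations_split[of S m "alternating R" "\<lambda>w. alternating R w \<and> odd (length w)"
      "alternating R", OF \<open>finite S\<close> \<open>m \<notin> S\<close> this]
  show "alt_count R (insert m S) =
      (\<Sum>B\<in>Pow S. (if odd (card B) then alt_count R B else 0) * alt_count R (S - B))"
    unfolding card_alternating_parity[where P = odd] alt_count_def[of R "insert m S"] alt_count_def[of R "S - _"]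
    by simp
next
  have "alternating (\<lambda>a b. R b a) (w1 @ m # w2) \<longleftrightarrow>
      (alternating (\<lambda>a b. R b a) w1 \<and> even (length w1)) \<and> alternating R w2" if "set w1 \<union> set w2 = S" for w1 w2
    using alternating_append_maximum[of w1 w2 R m] max that by auto
  from card_permutations_split[of S m "alternating (\<lambda>a b. R b a)"
      "\<lambda>w. alternating (\<lambda>a b. R b a) w \<and> even (length w)" "alternating R",
      OF \<open>finite S\<close> \<open>m \<notin> S\<close> this]
  show "alt_count (\<lambda>a b. R b a) (insert m S) =
      (\<Sum>B\<in>Pow S. (if even (card B) then alt_count (\<lambda>a b. R b a) B else 0) * alt_count R (S - B))"
    unfolding card_alternating_parity[where P = even] alt_count_def[of "\<lambda>a b. R b a" "insert m S"] alt_count_def[of R "S - _"]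
    by simp
qed

lemma sum_Pow_card:
  fixes f :: "nat \<Rightarrow> 'a::comm_semiring_1"
  assumes "finite S"
  shows "(\<Sum>B\<in>Pow S. f (card B)) = (\<Sum>j\<le>card S. of_nat (card S choose j) * f j)"
proof -
  have "(\<Sum>B\<in>Pow S. f (card B)) = (\<Sum>j\<le>card S. \<Sum>B\<in>{B \<in> Pow S. card B = j}. f (card B))"
    using assms by (intro sum.group[symmetric]) (auto intro: card_mono)
  also have "\<dots> = (\<Sum>j\<le>card S. of_nat (card S choose j) * f j)"
    using n_subsets[OF assms] by (intro sum.cong) auto
  finally show ?thesis .
qed

text \<open>The Euler zigzag numbers 1, 1, 1, 2, 5, 16, ...\<close>

definition zigzag :: "nat \<Rightarrow> nat" where
  "zigzag n = alt_count (<) {..<n}"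

text \<open>Splitting at the maximum for \<open><\<close> and at the minimum for \<open>>\<close> yields one and the same
  recurrence, which only involves cardinalities.\<close>

lemma alt_count_cong_card:
  fixes V W :: "nat set"
  assumes "finite V" "finite W" "card V = card W" "R \<in> {(<), (>)}" "R' \<in> {(<), (>)}"
  shows "alt_count R V = alt_count R' W"
  using assms
proof (induction "card V" arbitrary: V W R R' rule: less_induct)
  case less
  \<comment> \<open>Initial segments with \<open><\<close> serve as reference values. They turn the
    recurrence for any \<open>R\<close> and \<open>U\<close> into one expression in
    \<open>card V\<close>, so both sides of the claim agree.\<close>
  define F where "F = (\<lambda>(j :: nat) (k :: nat). (if odd j then alt_count (<) {..<j} else 0) * alt_count (<) {..<k})"
  have *: "alt_count R U = (\<Sum>j\<le>card V - 1. (card V - 1 choose j) * F j (card V - 1 - j))"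
    if U: "finite U" "card U = card V" "card V \<ge> 2" and R: "R \<in> {(<), (>)}"
    for U :: "nat set" and R
  proof -
    obtain m where m: "m \<in> U" "\<And>x. x \<in> U - {m} \<Longrightarrow> R x m \<and> \<not> R m x"
    proof (cases "R = (<)")
      case True
      show ?thesis
      proof (rule that)
        show "Max U \<in> U" using U by (intro Max_in) auto
        show "R x (Max U) \<and> \<not> R (Max U) x" if "x \<in> U - {Max U}" for x
        proof -
          have "x \<le> Max U" using that U by auto
          then show ?thesis using that R True by auto
        qed
      qed
    next
      case False
      show ?thesis
      proof (rule that)
        show "Min U \<in> U" using U by (intro Min_in) auto
        show "R x (Min U) \<and> \<not> R (Min U) x" if "x \<in> U - {Min U}" for x
        proof -
          have "Min U \<le> x" using that U by auto
          then show ?thesis using that R False by auto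
        qed
      qed
    qed
    define S where "S = U - {m}"
    have S: "finite S" "m \<notin> S" "insert m S = U" "card S = card V - 1"
      using U m by (auto simp: S_def)
    have "S \<noteq> {}" using S U by auto
    have "alt_count R U =
        (\<Sum>B\<in>Pow S. (if odd (card B) then alt_count R B else 0) * alt_count R (S - B))"
      using alt_count_insert_maximum[OF S(1) _ S(2) \<open>S \<noteq> {}\<close>, of R] m(2) S(3)
      by (simp add: S_def)
    also have "\<dots> = (\<Sum>B\<in>Pow S. F (card B) (card S - card B))"
    proof (rule sum.cong)
      fix B assume B: "B \<in> Pow S"
      then have "finite B" "card B \<le> card S" "card (S - B) = card S - card B"
        using card_mono[OF S(1), of B] S(1) by (auto simp: card_Diff_subset finite_subset)
      moreover have "alt_count R B = alt_count (<) {..<card B}"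
        using calculation S U R by (intro less) auto
      moreover have "alt_count R (S - B) = alt_count (<) {..<card S - card B}"
        using calculation S U R by (intro less) auto
      ultimately show "(if odd (card B) then alt_count R B else 0) * alt_count R (S - B) =
          F (card B) (card S - card B)" by (simp add: F_def)
    qed simp
    also have "\<dots> = (\<Sum>j\<le>card S. (card S choose j) * F j (card S - j))"
      using sum_Pow_card[OF S(1), of "\<lambda>j. F j (card S - j)"] by simp
    finally show ?thesis by (simp add: S)
  qed
  \<comment> \<open>The recurrence presupposes a letter besides the extreme one, so sizes 0 and 1
    are separate.\<close>
  consider "card V = 0" | "card V = 1" | "card V \<ge> 2" by linarith
  then show ?case
  proof cases
    case 1
    then show ?thesis using less.prems by auto
  next
    case 2
    then obtain x y where "V = {x}" "W = {y}" using less.prems by (metis card_1_singletonE)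
    then show ?thesis by simp
  next
    case 3
    then show ?thesis using *[of V R] *[of W R'] less.prems by simp
  qed
qed

lemma alt_count_eq_zigzag:
  fixes V :: "nat set"
  assumes "finite V" "R \<in> {(<), (>)}"
  shows "alt_count R V = zigzag (card V)"
  unfolding zigzag_def using assms by (intro alt_count_cong_card) auto

lemma zigzag_0 [simp]: "zigzag 0 = 1"
  by (simp add: zigzag_def)

text \<open>Both orientations are counted by the same number. Cut at the maximum, one contributes
  the left parts of odd size and the other those of even size, so together every subset occurs once.
  For \<open>n = 0\<close> the single word has both orientations but only one cut term, whence the
  extra 1.\<close>

lemma double_zigzag_Suc:
  "2 * zigzag (Suc n) =
    (if n = 0 then 1 else 0) + (\<Sum>j\<le>n. (n choose j) * (zigzag j * zigzag (n - j)))"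
proof (cases "n = 0")
  case True
  then show ?thesis by (simp add: zigzag_def lessThan_Suc)
next
  case False
  let ?S = "{..<n}"
  have "(if odd (card B) then alt_count (<) B else 0) * alt_count (<) (?S - B) +
      (if even (card B) then alt_count (>) B else 0) * alt_count (<) (?S - B) =
      zigzag (card B) * zigzag (n - card B)" if "B \<in> Pow ?S" for B
  proof -
    have "finite B" using that finite_subset by auto
    then show ?thesis
      using that by (simp add: alt_count_eq_zigzag card_Diff_subset)
  qed
  then have "alt_count (<) (insert n ?S) + alt_count (>) (insert n ?S) =
      (\<Sum>B\<in>Pow ?S. zigzag (card B) * zigzag (n - card B))"
    using False alt_count_insert_maximum[of ?S "(<)" n]
      alt_count_converse_insert_maximum[of ?S "(<)" n]
    by (simp add: lessThan_empty_iff bot_nat_def flip: sum.distrib)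
  also have "\<dots> = (\<Sum>j\<le>n. (n choose j) * (zigzag j * zigzag (n - j)))"
    using sum_Pow_card[of ?S "\<lambda>j. zigzag j * zigzag (n - j)"] by simp
  finally show ?thesis using False by (simp add: alt_count_eq_zigzag)
qed

section \<open>Decompositions into blocks\<close>

text \<open>The labelled set construction: the parts of a set partition of \<open>V\<close>, each
  carrying a structure from \<open>A\<close>. The partition itself is recovered through
  \<open>supp\<close>.\<close>

definition decomps :: "('b \<Rightarrow> 'a set) \<Rightarrow> 'b set \<Rightarrow> 'a set \<Rightarrow> 'b set set" where
  "decomps supp A V = {C. C \<subseteq> A \<and> (\<Union>b\<in>C. supp b) = V \<and>
     (\<forall>b\<in>C. \<forall>b'\<in>C. b \<noteq> b' \<longrightarrow> supp b \<inter> supp b' = {})}"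

text \<open>Nonempty supports make the decomposition of the empty set unique and keep a block from
  recurring in a decomposition of the complement of its support.\<close>

locale block_structure =
  fixes supp :: "'b \<Rightarrow> nat set" and A :: "'b set"
  assumes supp_nonempty: "b \<in> A \<Longrightarrow> supp b \<noteq> {}"
    and finite_blocks: "finite S \<Longrightarrow> finite {b \<in> A. supp b = S}"
begin

lemma finite_blocks_subset: "finite V \<Longrightarrow> finite {b \<in> A. supp b \<subseteq> V}"
proof -
  assume "finite V"
  have "{b \<in> A. supp b \<subseteq> V} = (\<Union>S\<in>Pow V. {b \<in> A. supp b = S})" by auto
  then show ?thesis using \<open>finite V\<close> finite_blocks finite_subset by (metis (no_types, lifting) PowD finite_Pow_iff finite_UN)
qed

lemma decomps_empty: "decomps supp A {} = {{}}"
  using supp_nonempty by (auto simp: decomps_def)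

lemma finite_decomp: "finite V \<Longrightarrow> C \<in> decomps supp A V \<Longrightarrow> finite C"
  by (rule finite_subset[OF _ finite_blocks_subset[of V]]) (auto simp: decomps_def)

lemma finite_decomps: "finite V \<Longrightarrow> finite (decomps supp A V)"
  by (rule finite_subset[of _ "Pow {b \<in> A. supp b \<subseteq> V}"])
     (auto simp: decomps_def finite_blocks_subset)

text \<open>Exactly one block contains \<open>m\<close>; what remains is an arbitrary decomposition
  of the complement, and weights multiply. This is the exponential formula in differential form, at
  the level of sets, with \<open>B\<close> the companions of \<open>m\<close>.\<close>

lemma sum_decomps_insert:
  fixes wt :: "'b \<Rightarrow> 'c :: comm_semiring_1"
  assumes "finite V" and "m \<notin> V"
  shows "(\<Sum>C\<in>decomps supp A (insert m V). \<Prod>b\<in>C. wt b) =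
    (\<Sum>B\<in>Pow V. (\<Sum>b | b \<in> A \<and> supp b = insert m B. wt b) *
      (\<Sum>C\<in>decomps supp A (V - B). \<Prod>b\<in>C. wt b))"
proof -
  let ?M = "{b \<in> A. m \<in> supp b \<and> supp b \<subseteq> insert m V}"
  let ?D = "decomps supp A"
  let ?X = "SIGMA b:?M. ?D (V - supp b)"
  have finM: "finite ?M"
    using finite_blocks_subset[of "insert m V"] assms(1) by (auto elim: rev_finite_subset)
  \<comment> \<open>Otherwise \<open>supp b\<close> would lie in its own complement. Hence inserting
    \<open>b\<close> really adds a factor \<open>wt b\<close>.\<close>
  have nin: "b \<notin> C" if "C \<in> ?D (V - supp b)" "b \<in> ?M" for b C
    using that supp_nonempty[of b] by (auto simp: decomps_def)
  have "bij_betw (\<lambda>(b, C). insert b C) ?X (?D (insert m V))" (is "bij_betw ?f _ _")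
    unfolding bij_betw_def
  proof
    show "inj_on ?f ?X"
    proof (rule inj_onI)
      fix p p' assume X: "p \<in> ?X" "p' \<in> ?X" and eq: "?f p = ?f p'"
      obtain b C b' C' where p: "p = (b, C)" "p' = (b', C')" by (metis surj_pair)
      have "m \<notin> (\<Union>b\<in>C. supp b)" "m \<notin> (\<Union>b\<in>C'. supp b)" "m \<in> supp b" "m \<in> supp b'"
        using X \<open>m \<notin> V\<close> by (auto simp: p decomps_def)
      with eq have "b = b'" by (auto simp: p)
      moreover from this have "C = C'"
        using eq nin X by (auto simp: p insert_ident)
      ultimately show "p = p'" by (simp add: p)
    qed
    show "?f ` ?X = ?D (insert m V)"
    proof (intro equalityI subsetI)
      fix C assume "C \<in> ?f ` ?X"
      then obtain b C' where C: "C = insert b C'" and b: "b \<in> ?M" and C': "C' \<in> ?D (V - supp b)"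
        by auto
      have "(\<Union>b\<in>C. supp b) = insert m V"
        using b C' by (auto simp: C decomps_def)
      moreover have "supp b \<inter> supp b' = {}" if "b' \<in> C'" for b'
        using that C' by (auto simp: decomps_def)
      ultimately show "C \<in> ?D (insert m V)"
        using b C' by (auto simp: C decomps_def)
    next
      fix C assume C: "C \<in> ?D (insert m V)"
      then have "m \<in> (\<Union>b\<in>C. supp b)" by (auto simp: decomps_def)
      then obtain b where b: "b \<in> C" "m \<in> supp b" by auto
      have disj: "supp b \<inter> supp b' = {}" if "b' \<in> C - {b}" for b'
        using C b(1) that unfolding decomps_def by blast
      have U: "(\<Union>b\<in>C. supp b) = insert m V" using C by (simp add: decomps_def)
      then have "supp b \<union> (\<Union>b\<in>C - {b}. supp b) = insert m V" using b by auto
      then have "(\<Union>b\<in>C - {b}. supp b) = V - supp b"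
        using disj b \<open>m \<notin> V\<close> by blast
      then have "C - {b} \<in> ?D (V - supp b)"
        using C by (auto simp: decomps_def)
      moreover have "b \<in> ?M" using C b by (auto simp: decomps_def)
      ultimately have "(b, C - {b}) \<in> ?X" by auto
      moreover have "C = ?f (b, C - {b})" using b by auto
      ultimately show "C \<in> ?f ` ?X" by (rule rev_image_eqI)
    qed
  qed
  then have "(\<Sum>C\<in>?D (insert m V). \<Prod>b\<in>C. wt b) = (\<Sum>(b, C)\<in>?X. \<Prod>b\<in>insert b C. wt b)"
    by (simp add: sum.reindex_bij_betw[symmetric] case_prod_unfold)
  also have "\<dots> = (\<Sum>(b, C)\<in>?X. wt b * (\<Prod>b\<in>C. wt b))"
    using nin finite_decomp[of "V - supp _"] \<open>finite V\<close> by (intro sum.cong) auto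
  also have "\<dots> = (\<Sum>b\<in>?M. wt b * (\<Sum>C\<in>?D (V - supp b). \<Prod>b\<in>C. wt b))"
    using finM finite_decomps \<open>finite V\<close> by (simp add: sum.Sigma[symmetric] sum_distrib_left)
  also have "\<dots> = (\<Sum>B\<in>Pow V. \<Sum>b | b \<in> ?M \<and> supp b - {m} = B.
      wt b * (\<Sum>C\<in>?D (V - supp b). \<Prod>b\<in>C. wt b))"
    using \<open>finite V\<close> finM by (intro sum.group[symmetric]) auto
  also have "\<dots> = (\<Sum>B\<in>Pow V. \<Sum>b | b \<in> A \<and> supp b = insert m B.
      wt b * (\<Sum>C\<in>?D (V - B). \<Prod>b\<in>C. wt b))"
  proof (intro sum.cong refl)
    fix B assume "B \<in> Pow V"
    then show "{b. b \<in> ?M \<and> supp b - {m} = B} = {b. b \<in> A \<and> supp b = insert m B}"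
      using \<open>m \<notin> V\<close> by auto
  next
    fix B b assume "B \<in> Pow V" "b \<in> {b. b \<in> A \<and> supp b = insert m B}"
    then have "V - supp b = V - B" using \<open>m \<notin> V\<close> by auto
    then show "wt b * (\<Sum>C\<in>?D (V - supp b). \<Prod>b\<in>C. wt b) =
        wt b * (\<Sum>C\<in>?D (V - B). \<Prod>b\<in>C. wt b)" by simp
  qed
  finally show ?thesis by (simp add: sum_distrib_right)
qed

text \<open>Dependence on size alone is the hypothesis \<open>Z\<close> here, because the induction
  that establishes it runs on this very recurrence.\<close>

lemma sum_decomps_Suc:
  fixes wt :: "'b \<Rightarrow> 'c :: comm_semiring_1"
  assumes h: "\<And>S. finite S \<Longrightarrow> S \<noteq> {} \<Longrightarrow> (\<Sum>b | b \<in> A \<and> supp b = S. wt b) = h (card S)"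
    and "finite V" and "m \<notin> V"
    and Z: "\<And>U. U \<subseteq> V \<Longrightarrow> (\<Sum>C\<in>decomps supp A U. \<Prod>b\<in>C. wt b) = z (card U)"
  shows "(\<Sum>C\<in>decomps supp A (insert m V). \<Prod>b\<in>C. wt b) =
    (\<Sum>j\<le>card V. of_nat (card V choose j) * (h (Suc j) * z (card V - j)))"
proof -
  have "(\<Sum>C\<in>decomps supp A (insert m V). \<Prod>b\<in>C. wt b) =
      (\<Sum>B\<in>Pow V. h (Suc (card B)) * z (card V - card B))"
    unfolding sum_decomps_insert[OF assms(2,3)]
  proof (rule sum.cong)
    fix B assume B: "B \<in> Pow V"
    then have "finite B" "m \<notin> B" using assms by (auto intro: finite_subset)
    then show "(\<Sum>b | b \<in> A \<and> supp b = insert m B. wt b) *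
        (\<Sum>C\<in>decomps supp A (V - B). \<Prod>b\<in>C. wt b) = h (Suc (card B)) * z (card V - card B)"
      using B by (simp add: h Z card_Diff_subset)
  qed simp
  then show ?thesis using sum_Pow_card[OF assms(2)] by simp
qed

text \<open>Removing a block leaves a set with gaps, so a recurrence on initial segments requires
  invariance under the choice of ground set. Both sides satisfy the same recurrence in
  sizes.\<close>

lemma sum_decomps_card:
  fixes wt :: "'b \<Rightarrow> 'c :: comm_semiring_1"
  assumes h: "\<And>S. finite S \<Longrightarrow> S \<noteq> {} \<Longrightarrow> (\<Sum>b | b \<in> A \<and> supp b = S. wt b) = h (card S)"
    and "finite V"
  shows "(\<Sum>C\<in>decomps supp A V. \<Prod>b\<in>C. wt b) = (\<Sum>C\<in>decomps supp A {..<card V}. \<Prod>b\<in>C. wt b)"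
  using assms(2)
proof (induction "card V" arbitrary: V rule: less_induct)
  case less
  show ?case
  proof (cases "V = {}")
    case True
    then show ?thesis by simp
  next
    case False
    then obtain m S where V: "V = insert m S" "m \<notin> S" by (metis all_not_in_conv mk_disjoint_insert)
    then have S: "finite S" "card V = Suc (card S)" using less.prems by auto
    have IH: "(\<Sum>C\<in>decomps supp A U. \<Prod>b\<in>C. wt b) = (\<Sum>C\<in>decomps supp A {..<card U}. \<Prod>b\<in>C. wt b)"
      if "finite U" "card U \<le> card S" for U
      using that S by (intro less) auto
    have "U \<subseteq> S \<Longrightarrow> card U \<le> card S" for U using S by (auto intro: card_mono)
    then show ?thesis
      unfolding S lessThan_Suc unfolding V
      using S sum_decomps_Suc[OF h S(1) V(2) IH]
        sum_decomps_Suc[OF h _ _ IH, of "{..<card S}" "card S"]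
      by (simp add: finite_subset subset_eq_atLeast0_lessThan_card atLeast0LessThan)
  qed
qed

lemma sum_decomps_lessThan_Suc:
  fixes wt :: "'b \<Rightarrow> 'c :: comm_semiring_1"
  assumes h: "\<And>S. finite S \<Longrightarrow> S \<noteq> {} \<Longrightarrow> (\<Sum>b | b \<in> A \<and> supp b = S. wt b) = h (card S)"
  shows "(\<Sum>C\<in>decomps supp A {..<Suc n}. \<Prod>b\<in>C. wt b) =
    (\<Sum>j\<le>n. of_nat (n choose j) * (h (Suc j) * (\<Sum>C\<in>decomps supp A {..<n - j}. \<Prod>b\<in>C. wt b)))"
  unfolding lessThan_Suc
  using sum_decomps_Suc[OF h _ _ sum_decomps_card[OF h], of "{..<n}" n]
  by (simp add: finite_subset)

end

section \<open>Cycle decomposition of partial permutations\<close>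

text \<open>A full cycle is tagged with \<open>True\<close>, a partial cycle with \<open>False\<close>.\<close>

definition word_blocks :: "(bool \<times> nat list) set" where
  "word_blocks = {(b, w). w \<noteq> [] \<and> distinct w \<and> (b \<longrightarrow> hd w = Min (set w))}"

abbreviation block_support :: "bool \<times> nat list \<Rightarrow> nat set" where
  "block_support \<beta> \<equiv> set (snd \<beta>)"

definition linked :: "bool \<times> nat list \<Rightarrow> nat \<Rightarrow> nat \<Rightarrow> bool" where
  "linked \<beta> i j \<longleftrightarrow> (\<exists>l. Suc l < length (snd \<beta>) \<and> i = snd \<beta> ! l \<and> j = snd \<beta> ! Suc l) \<or>
     (fst \<beta> \<and> snd \<beta> \<noteq> [] \<and> i = last (snd \<beta>) \<and> j = hd (snd \<beta>))"

text \<open>Formulated for a relation instead of a matrix, so that passing to cycles and back can be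
  studied without entries and dimensions.\<close>

definition blocks_of :: "nat set \<Rightarrow> (nat \<Rightarrow> nat \<Rightarrow> bool) \<Rightarrow> (bool \<times> nat list) set" where
  "blocks_of V r = {(b, w). (b, w) \<in> word_blocks \<and> set w \<subseteq> V \<and>
     (\<forall>l. Suc l < length w \<longrightarrow> r (w ! l) (w ! Suc l)) \<and>
     (if b then r (last w) (hd w)
      else (\<forall>x\<in>V. \<not> r x (hd w)) \<and> (\<forall>y\<in>V. \<not> r (last w) y))}"

lemma linked_in_support: "linked \<beta> i j \<Longrightarrow> i \<in> block_support \<beta> \<and> j \<in> block_support \<beta>"
  by (auto simp: linked_def)

text \<open>Cyclic indices cover inner links and the closing link at once; uniqueness of successors
  and predecessors then reduces to distinctness of the letters.\<close>

lemma linked_index: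
  assumes "linked \<beta> i j"
  shows "\<exists>l<length (snd \<beta>). i = snd \<beta> ! l \<and> j = snd \<beta> ! (Suc l mod length (snd \<beta>))"
  using assms unfolding linked_def
proof (elim disjE exE conjE)
  fix l assume "Suc l < length (snd \<beta>)" "i = snd \<beta> ! l" "j = snd \<beta> ! Suc l"
  then show ?thesis by (intro exI[of _ l]) simp
next
  assume "snd \<beta> \<noteq> []" "i = last (snd \<beta>)" "j = hd (snd \<beta>)"
  then show ?thesis
    by (intro exI[of _ "length (snd \<beta>) - 1"]) (simp add: last_conv_nth hd_conv_nth)
qed

lemma linked_right_unique:
  assumes "distinct (snd \<beta>)" "linked \<beta> i j" "linked \<beta> i j'"
  shows "j = j'"
  using linked_index[OF assms(2)] linked_index[OF assms(3)] assms(1)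
  by (auto simp: nth_eq_iff_index_eq)

lemma linked_left_unique:
  assumes "distinct (snd \<beta>)" "linked \<beta> i j" "linked \<beta> i' j"
  shows "i = i'"
proof -
  let ?n = "length (snd \<beta>)"
  obtain l l' where l: "l < ?n" "i = snd \<beta> ! l" "l' < ?n" "i' = snd \<beta> ! l'"
    and "snd \<beta> ! (Suc l mod ?n) = snd \<beta> ! (Suc l' mod ?n)"
    using linked_index[OF assms(2)] linked_index[OF assms(3)] by metis
  moreover have "0 < ?n" using l(1) by linarith
  then have "Suc l mod ?n < ?n" "Suc l' mod ?n < ?n" by simp_all
  ultimately have "Suc l mod ?n = Suc l' mod ?n"
    using assms(1) nth_eq_iff_index_eq by blast
  then have "l = l'" using l by (simp add: mod_Suc split: if_splits)
  then show ?thesis using l by simp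
qed

section \<open>The cycles of a finite partial injection\<close>

locale partial_injection =
  fixes V :: "nat set" and r :: "nat \<Rightarrow> nat \<Rightarrow> bool"
  assumes finite_V: "finite V"
    and rel_in: "r i j \<Longrightarrow> i \<in> V \<and> j \<in> V"
    and rel_right_unique: "r i j \<Longrightarrow> r i j' \<Longrightarrow> j = j'"
    and rel_left_unique: "r i j \<Longrightarrow> r i' j \<Longrightarrow> i = i'"
begin

text \<open>No arrow enters or leaves a block: each letter already has its neighbours inside, and
  the two ends are either joined or have no arrow at all.\<close>

lemma block_closed:
  assumes \<beta>: "(b, w) \<in> blocks_of V r" and "r x y"
  shows "x \<in> set w \<longleftrightarrow> y \<in> set w"
proof
  assume "x \<in> set w"
  then obtain l where l: "l < length w" "x = w ! l" by (auto simp: in_set_conv_nth)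
  show "y \<in> set w"
  proof (cases "Suc l < length w")
    case True
    then have "r x (w ! Suc l)" using \<beta> l by (auto simp: blocks_of_def)
    then show ?thesis using rel_right_unique[OF \<open>r x y\<close>] True by auto
  next
    case False
    then have "l = length w - 1" "w \<noteq> []" using l by auto
    then have "x = last w" using l by (simp add: last_conv_nth)
    then have "r x (hd w)"
      using \<beta> \<open>r x y\<close> rel_in by (auto simp: blocks_of_def split: if_splits)
    then show ?thesis using rel_right_unique[OF \<open>r x y\<close>] \<open>w \<noteq> []\<close> by auto
  qed
next
  assume "y \<in> set w"
  then obtain l where l: "l < length w" "y = w ! l" by (auto simp: in_set_conv_nth)
  show "x \<in> set w"
  proof (cases l)
    case (Suc k)
    then have "r (w ! k) y" using \<beta> l by (auto simp: blocks_of_def)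
    then show ?thesis using rel_left_unique[OF \<open>r x y\<close>] Suc l by auto
  next
    case 0
    then have "y = hd w" "w \<noteq> []" using l by (auto simp: hd_conv_nth)
    then have "r (last w) y"
      using \<beta> \<open>r x y\<close> rel_in by (auto simp: blocks_of_def split: if_splits)
    then show ?thesis using rel_left_unique[OF \<open>r x y\<close>] \<open>w \<noteq> []\<close> by auto
  qed
qed

text \<open>Consecutive letters are joined by arrows. With \<open>block_closed\<close>, this makes
  the supports of blocks connected components.\<close>

lemma block_connected:
  assumes \<beta>: "(b, w) \<in> blocks_of V r" and closed: "\<And>x y. r x y \<Longrightarrow> x \<in> U \<longleftrightarrow> y \<in> U"
    and "set w \<inter> U \<noteq> {}"
  shows "set w \<subseteq> U"
proof -
  have "w ! l \<in> U \<longleftrightarrow> w ! 0 \<in> U" if "l < length w" for l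
    using that
  proof (induction l)
    case (Suc l)
    then have "r (w ! l) (w ! Suc l)" using \<beta> by (auto simp: blocks_of_def)
    then show ?case using closed Suc by auto
  qed simp
  then have "x \<in> U \<longleftrightarrow> w ! 0 \<in> U" if "x \<in> set w" for x
    using that unfolding in_set_conv_nth by blast
  then show ?thesis using assms(3) by blast
qed

text \<open>This reads off the tag and the first letter from the relation: a letter without preimage
  exists only in a partial cycle and is its head.\<close>

lemma ex_rel_into_iff:
  assumes \<beta>: "(b, w) \<in> blocks_of V r" and "y \<in> set w"
  shows "(\<exists>x. r x y) \<longleftrightarrow> b \<or> y \<noteq> hd w"
proof (cases "y = hd w")
  case True
  then show ?thesis using \<beta> rel_in by (auto simp: blocks_of_def split: if_splits)
next
  case False
  obtain l where l: "l < length w" "y = w ! l" using assms by (auto simp: in_set_conv_nth)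
  with False obtain k where "l = Suc k" by (cases l) (auto simp: hd_conv_nth)
  then have "r (w ! k) y" using \<beta> l by (auto simp: blocks_of_def)
  then show ?thesis using False by auto
qed

text \<open>Meeting blocks have the same support. Their tags agree by
  \<open>ex_rel_into_iff\<close>, their heads are either the letter without preimage or the minimum,
  and successors then force the words letter by letter.\<close>

lemma blocks_disjoint:
  assumes \<beta>: "(b, w) \<in> blocks_of V r" and \<beta>': "(b', w') \<in> blocks_of V r"
    and "set w \<inter> set w' \<noteq> {}"
  shows "(b, w) = (b', w')"
proof -
  have set_eq: "set w = set w'"
    using block_connected[OF \<beta>, of "set w'"] block_connected[OF \<beta>', of "set w"]
      block_closed[OF \<beta>] block_closed[OF \<beta>'] assms(3) by blast
  have props: "w \<noteq> []" "distinct w" "b \<longrightarrow> hd w = Min (set w)" "w' \<noteq> []" "distinct w'"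
      "b' \<longrightarrow> hd w' = Min (set w')"
    using \<beta> \<beta>' by (auto simp: blocks_of_def word_blocks_def)
  have hd_in: "hd w \<in> set w'" "hd w' \<in> set w" using props(1,4) set_eq hd_in_set by metis+
  have "b \<longleftrightarrow> b' \<or> hd w \<noteq> hd w'"
    using ex_rel_into_iff[OF \<beta>, of "hd w"] ex_rel_into_iff[OF \<beta>' hd_in(1)] props(1) by simp
  moreover have "b' \<longleftrightarrow> b \<or> hd w' \<noteq> hd w"
    using ex_rel_into_iff[OF \<beta>', of "hd w'"] ex_rel_into_iff[OF \<beta> hd_in(2)] props(4) by simp
  ultimately have "b = b' \<and> hd w = hd w'" using props set_eq by metis
  moreover have len: "length w = length w'"
    using props set_eq distinct_card by metis
  moreover have "w ! l = w' ! l" if "l < length w" for l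
    using that
  proof (induction l)
    case 0
    then show ?case using calculation props by (simp add: hd_conv_nth)
  next
    case (Suc l)
    then have "r (w ! l) (w ! Suc l)" "r (w' ! l) (w' ! Suc l)"
      using \<beta> \<beta>' len by (auto simp: blocks_of_def)
    then show ?case using Suc rel_right_unique by auto
  qed
  ultimately show ?thesis by (auto intro: nth_equalityI)
qed

text \<open>A longest path through \<open>v\<close> is either a partial cycle or closes up to a full
  cycle.\<close>

lemma ex_block:
  assumes "v \<in> V"
  shows "\<exists>\<beta>\<in>blocks_of V r. v \<in> block_support \<beta>"
proof -
  define Q where "Q w \<longleftrightarrow> w \<noteq> [] \<and> distinct w \<and> v \<in> set w \<and> set w \<subseteq> V \<and>
      (\<forall>l. Suc l < length w \<longrightarrow> r (w ! l) (w ! Suc l))" for w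
  have "Q [v]" using assms by (simp add: Q_def)
  moreover have "length w \<le> card V" if "Q w" for w
    using that finite_V by (metis Q_def card_mono distinct_card)
  ultimately have "\<exists>w. Q w \<and> (\<forall>w'. Q w' \<longrightarrow> length w' \<le> length w)"
    by (intro ex_has_greatest_nat[of Q "[v]" length "Suc (card V)"]) (auto simp: less_Suc_eq_le)
  then obtain w where w: "Q w" and max: "\<And>w'. Q w' \<Longrightarrow> length w' \<le> length w"
    by blast
  have w_props: "w \<noteq> []" "distinct w" "v \<in> set w" "set w \<subseteq> V"
    and step: "\<And>l. Suc l < length w \<Longrightarrow> r (w ! l) (w ! Suc l)"
    using w by (auto simp: Q_def)
  \<comment> \<open>Maximality forces a successor of the last letter back into \<open>w\<close>. If
    there is none, a predecessor of the head is new and contradicts maximality.\<close>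
  consider (cycle) y where "r (last w) y"
    | (extend) x where "r x (hd w)" "\<And>y. \<not> r (last w) y"
    | (path) "\<And>x. \<not> r x (hd w)" "\<And>y. \<not> r (last w) y"
    by blast
  then show ?thesis
  proof cases
    case cycle
    have "y \<in> set w"
    proof (rule ccontr)
      assume "y \<notin> set w"
      have "r ((w @ [y]) ! l) ((w @ [y]) ! Suc l)" if "Suc l < length (w @ [y])" for l
      proof (cases "Suc l < length w")
        case True
        then show ?thesis using step by (simp add: nth_append)
      next
        case False
        then have "Suc l = length w" using that by simp
        then show ?thesis using cycle w_props(1)
          by (auto simp: nth_append last_conv_nth simp flip: \<open>Suc l = length w\<close>)
      qed
      then have "Q (w @ [y])"
        using \<open>y \<notin> set w\<close> w_props rel_in[OF cycle] by (auto simp: Q_def)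
      then show False using max[of "w @ [y]"] by simp
    qed
    then obtain l where l: "l < length w" "y = w ! l" by (auto simp: in_set_conv_nth)
    \<comment> \<open>A later letter has its predecessor inside \<open>w\<close>; by injectivity
      this would be the last letter, which has no letter after it.\<close>
    have y_hd: "y = w ! 0"
    proof (cases l)
      case (Suc k)
      then have "r (w ! k) y" using l step by auto
      then have "w ! k = w ! (length w - 1)"
        using cycle rel_left_unique w_props by (metis last_conv_nth)
      then have "k = length w - 1"
        using w_props l Suc by (subst (asm) nth_eq_iff_index_eq) auto
      then show ?thesis using Suc l by simp
    qed (use l in simp)
    have cyc: "r (w ! l) (w ! (Suc l mod length w))" if "l < length w" for l
    proof (cases "Suc l = length w")
      case True
      then have "l = length w - 1" by simp
      then show ?thesis
        using cycle True w_props by (simp add: last_conv_nth y_hd)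
    next
      case False
      then show ?thesis using that step by simp
    qed
    \<comment> \<open>The cyclic form \<open>cyc\<close> is invariant under rotation, so the word
      can be started at its minimum as \<open>word_blocks\<close> demands.\<close>
    obtain k where k: "k < length w" "w ! k = Min (set w)"
      using Min_in[of "set w"] w_props by (auto simp: in_set_conv_nth)
    define w' where "w' = rotate k w"
    have len: "length w' = length w" and set: "set w' = set w" and "distinct w'" "w' \<noteq> []"
      using w_props by (auto simp: w'_def)
    have nth: "w' ! i = w ! ((k + i) mod length w)" if "i < length w" for i
      using that by (simp add: w'_def nth_rotate)
    have cyc': "r (w' ! i) (w' ! (Suc i mod length w))" if "i < length w" for i
    proof -
      have "Suc ((k + i) mod length w) mod length w = (k + Suc i mod length w) mod length w"
        by (simp add: mod_Suc_eq mod_add_right_eq)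
      moreover have "0 < length w" using that by linarith
      ultimately show ?thesis
        using cyc[of "(k + i) mod length w"] nth[OF that] nth[of "Suc i mod length w"] by simp
    qed
    have "hd w' = Min (set w')"
      using k nth[of 0] w_props \<open>w' \<noteq> []\<close> by (simp add: hd_conv_nth set)
    moreover have "r (w' ! i) (w' ! Suc i)" if "Suc i < length w'" for i
      using cyc'[of i] that by (simp add: len)
    moreover have "r (last w') (hd w')"
      using cyc'[of "length w - 1"] w_props \<open>w' \<noteq> []\<close> by (simp add: last_conv_nth hd_conv_nth len)
    ultimately have "(True, w') \<in> blocks_of V r"
      using \<open>distinct w'\<close> \<open>w' \<noteq> []\<close> w_props set by (simp add: blocks_of_def word_blocks_def)
    then show ?thesis using w_props set by (intro bexI[of _ "(True, w')"]) auto
  next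
    case extend
    have "x \<notin> set w"
    proof
      assume "x \<in> set w"
      then obtain l where l: "l < length w" "x = w ! l" by (auto simp: in_set_conv_nth)
      have "l \<noteq> length w - 1" using extend l w_props by (metis last_conv_nth)
      then have "Suc l < length w" using l by simp
      then have "w ! Suc l = w ! 0"
        using step[of l] extend(1) l rel_right_unique w_props by (metis hd_conv_nth)
      then show False
        using \<open>Suc l < length w\<close> w_props by (subst (asm) nth_eq_iff_index_eq) auto
    qed
    moreover have "r ((x # w) ! l) ((x # w) ! Suc l)" if "Suc l < length (x # w)" for l
      using that step extend(1) w_props by (cases l) (auto simp: hd_conv_nth)
    ultimately have "Q (x # w)"
      using w_props rel_in[OF extend(1)] by (auto simp: Q_def)
    then show ?thesis using max[of "x # w"] by simp
  next
    case path
    then have "(False, w) \<in> blocks_of V r"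
      using w_props step by (simp add: blocks_of_def word_blocks_def)
    then show ?thesis using w_props by (intro bexI[of _ "(False, w)"]) auto
  qed
qed

lemma blocks_of_decomp: "blocks_of V r \<in> decomps block_support word_blocks V"
proof -
  have "blocks_of V r \<subseteq> word_blocks" unfolding blocks_of_def by blast
  moreover have "(\<Union>\<beta>\<in>blocks_of V r. block_support \<beta>) = V"
    using ex_block by (fastforce simp: blocks_of_def)
  moreover have "block_support \<beta> \<inter> block_support \<beta>' = {}"
    if "\<beta> \<in> blocks_of V r" "\<beta>' \<in> blocks_of V r" "\<beta> \<noteq> \<beta>'" for \<beta> \<beta>'
    using blocks_disjoint[of "fst \<beta>" "snd \<beta>" "fst \<beta>'" "snd \<beta>'"] that by auto
  ultimately show ?thesis by (simp add: decomps_def)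
qed

lemma ex_linked_blocks_of_iff: "(\<exists>\<beta>\<in>blocks_of V r. linked \<beta> i j) \<longleftrightarrow> r i j"
proof
  assume "\<exists>\<beta>\<in>blocks_of V r. linked \<beta> i j"
  then show "r i j" by (auto simp: blocks_of_def linked_def)
next
  assume "r i j"
  then obtain b w where \<beta>: "(b, w) \<in> blocks_of V r" and "i \<in> set w"
    using ex_block[of i] rel_in by auto
  then obtain l where l: "l < length w" "i = w ! l" by (auto simp: in_set_conv_nth)
  have "linked (b, w) i j"
  proof (cases "Suc l < length w")
    case True
    then have "r i (w ! Suc l)" using \<beta> l by (auto simp: blocks_of_def)
    then show ?thesis using rel_right_unique[OF \<open>r i j\<close>] True l by (auto simp: linked_def)
  next
    case False
    then have "l = length w - 1" "w \<noteq> []" using l by auto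
    then have "i = last w" using l by (simp add: last_conv_nth)
    then have "b" "r i (hd w)"
      using \<beta> \<open>r i j\<close> rel_in by (auto simp: blocks_of_def split: if_splits)
    then show ?thesis
      using rel_right_unique[OF \<open>r i j\<close>] \<open>w \<noteq> []\<close> \<open>i = last w\<close> by (auto simp: linked_def)
  qed
  then show "\<exists>\<beta>\<in>blocks_of V r. linked \<beta> i j" using \<beta> by blast
qed

text \<open>Only the end of a partial cycle lacks an image; for matrices, this identifies the number
  of zero rows with that of partial cycles.\<close>

lemma bij_betw_last_blocks_of:
  "bij_betw (\<lambda>\<beta>. last (snd \<beta>)) {\<beta> \<in> blocks_of V r. \<not> fst \<beta>} {i \<in> V. \<forall>j. \<not> r i j}"
  unfolding bij_betw_def
proof
  have last_in: "last (snd \<beta>) \<in> block_support \<beta>" if "\<beta> \<in> blocks_of V r" for \<beta>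
    using that by (auto simp: blocks_of_def word_blocks_def)
  show "inj_on (\<lambda>\<beta>. last (snd \<beta>)) {\<beta> \<in> blocks_of V r. \<not> fst \<beta>}"
  proof (rule inj_onI)
    fix \<beta> \<beta>' assume "\<beta> \<in> {\<beta> \<in> blocks_of V r. \<not> fst \<beta>}" "\<beta>' \<in> {\<beta> \<in> blocks_of V r. \<not> fst \<beta>}"
      "last (snd \<beta>) = last (snd \<beta>')"
    moreover from this obtain w w' where eq: "\<beta> = (False, w)" "\<beta>' = (False, w')"
      by (cases \<beta>, cases \<beta>') auto
    ultimately show "\<beta> = \<beta>'"
      using blocks_disjoint[of False w False w'] last_in[of \<beta>] last_in[of \<beta>'] by auto
  qed
  show "(\<lambda>\<beta>. last (snd \<beta>)) ` {\<beta> \<in> blocks_of V r. \<not> fst \<beta>} = {i \<in> V. \<forall>j. \<not> r i j}"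
  proof (intro equalityI subsetI)
    fix i assume "i \<in> (\<lambda>\<beta>. last (snd \<beta>)) ` {\<beta> \<in> blocks_of V r. \<not> fst \<beta>}"
    then obtain w where "i = last w" "(False, w) \<in> blocks_of V r" by auto
    then show "i \<in> {i \<in> V. \<forall>j. \<not> r i j}"
      using last_in[of "(False, w)"] rel_in by (auto simp: blocks_of_def)
  next
    fix i assume i: "i \<in> {i \<in> V. \<forall>j. \<not> r i j}"
    then obtain b w where \<beta>: "(b, w) \<in> blocks_of V r" and "i \<in> set w"
      using ex_block[of i] by auto
    then obtain l where l: "l < length w" "i = w ! l" by (auto simp: in_set_conv_nth)
    have "\<not> Suc l < length w" using \<beta> i l by (auto simp: blocks_of_def)
    then have "l = length w - 1" "w \<noteq> []" using l by auto
    then have "i = last w" using l by (simp add: last_conv_nth)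
    moreover have "\<not> b" using calculation \<beta> i by (auto simp: blocks_of_def)
    ultimately show "i \<in> (\<lambda>\<beta>. last (snd \<beta>)) ` {\<beta> \<in> blocks_of V r. \<not> fst \<beta>}"
      using \<beta> by force
  qed
qed

end

text \<open>The inverse direction: disjoint supports let the unique successors and predecessors
  within single blocks pass to the union of all links.\<close>

lemma
  assumes "finite V" and C: "C \<in> decomps block_support word_blocks V"
  shows partial_injection_linked: "partial_injection V (\<lambda>i j. \<exists>\<beta>\<in>C. linked \<beta> i j)"
    and blocks_of_linked: "blocks_of V (\<lambda>i j. \<exists>\<beta>\<in>C. linked \<beta> i j) = C"
proof -
  have same: "\<beta> = \<beta>'"
    if "\<beta> \<in> C" "\<beta>' \<in> C" "i \<in> block_support \<beta>" "i \<in> block_support \<beta>'" for \<beta> \<beta>' i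
    using C that unfolding decomps_def by blast
  have dist: "distinct (snd \<beta>)" "snd \<beta> \<noteq> []" if "\<beta> \<in> C" for \<beta>
    using C that by (auto simp: decomps_def word_blocks_def)
  have cover: "(\<Union>\<beta>\<in>C. block_support \<beta>) = V" using C by (simp add: decomps_def)
  interpret partial_injection V "\<lambda>i j. \<exists>\<beta>\<in>C. linked \<beta> i j"
  proof
    show "finite V" by fact
    show "i \<in> V \<and> j \<in> V" if "\<exists>\<beta>\<in>C. linked \<beta> i j" for i j
      using that cover linked_in_support by blast
    show "j = j'" if "\<exists>\<beta>\<in>C. linked \<beta> i j" "\<exists>\<beta>\<in>C. linked \<beta> i j'" for i j j'
      using that same linked_in_support linked_right_unique[OF dist(1)] by metis
    show "i = i'" if "\<exists>\<beta>\<in>C. linked \<beta> i j" "\<exists>\<beta>\<in>C. linked \<beta> i' j" for i i' j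
      using that same linked_in_support linked_left_unique[OF dist(1)] by metis
  qed
  show "partial_injection V (\<lambda>i j. \<exists>\<beta>\<in>C. linked \<beta> i j)" by unfold_locales
  let ?B = "blocks_of V (\<lambda>i j. \<exists>\<beta>\<in>C. linked \<beta> i j)"
  have sub: "C \<subseteq> ?B"
  proof
    fix \<beta> assume "\<beta> \<in> C"
    obtain b w where \<beta>: "\<beta> = (b, w)" by (cases \<beta>)
    have w: "(b, w) \<in> word_blocks" "w \<noteq> []" "distinct w"
      using C \<open>\<beta> \<in> C\<close> by (auto simp: \<beta> decomps_def word_blocks_def)
    have "set w \<subseteq> V" using \<open>\<beta> \<in> C\<close> cover by (auto simp: \<beta>)
    moreover have "linked \<beta> (w ! l) (w ! Suc l)" if "Suc l < length w" for l
      using that by (auto simp: \<beta> linked_def)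
    moreover have "linked \<beta> (last w) (hd w)" if b
      using that w by (auto simp: \<beta> linked_def)
    moreover have "\<not> linked \<beta>' x (hd w)" if "\<not> b" "\<beta>' \<in> C" for \<beta>' x
    proof
      assume "linked \<beta>' x (hd w)"
      moreover from this have "\<beta>' = \<beta>"
        using same[of \<beta>' \<beta> "hd w"] linked_in_support[of \<beta>' x "hd w"] that \<open>\<beta> \<in> C\<close> w by (auto simp: \<beta>)
      ultimately show False
        using that w by (auto simp: \<beta> linked_def hd_conv_nth nth_eq_iff_index_eq)
    qed
    moreover have "\<not> linked \<beta>' (last w) y" if "\<not> b" "\<beta>' \<in> C" for \<beta>' y
    proof
      assume "linked \<beta>' (last w) y"
      moreover from this have "\<beta>' = \<beta>"
        using same[of \<beta>' \<beta> "last w"] linked_in_support[of \<beta>' "last w" y] that \<open>\<beta> \<in> C\<close> w by (auto simp: \<beta>)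
      ultimately show False
        using that w by (auto simp: \<beta> linked_def last_conv_nth nth_eq_iff_index_eq)
    qed
    ultimately show "\<beta> \<in> ?B"
      using w \<open>\<beta> \<in> C\<close> unfolding blocks_of_def \<beta> by auto
  qed
  \<comment> \<open>\<open>C\<close> covers \<open>V\<close>, so any block meets a member of
    \<open>C\<close>. That member is itself a block by \<open>sub\<close>, and meeting blocks
    coincide.\<close>
  moreover have "?B \<subseteq> C"
  proof
    fix \<beta> assume "\<beta> \<in> ?B"
    moreover obtain b w where \<beta>: "\<beta> = (b, w)" by (cases \<beta>)
    ultimately have "hd w \<in> V" "hd w \<in> set w" by (auto simp: blocks_of_def word_blocks_def)
    then obtain \<beta>' where "\<beta>' \<in> C" "hd w \<in> block_support \<beta>'" using cover by blast
    then show "\<beta> \<in> C"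
      using blocks_disjoint[of b w "fst \<beta>'" "snd \<beta>'"] sub \<open>\<beta> \<in> ?B\<close> \<open>hd w \<in> set w\<close> by (auto simp: \<beta>)
  qed
  ultimately show "?B = C" by blast
qed

section \<open>Matrices as partial injections\<close>

lemma partial_injection_maps_to:
  assumes "P \<in> partial_perms n k"
  shows "partial_injection {..<n} (maps_to P)"
proof
  have dims: "dim_row P = n" "dim_col P = n" using assms by (auto simp: partial_perms_def)
  show "i \<in> {..<n} \<and> j \<in> {..<n}" if "maps_to P i j" for i j
    using that by (simp add: maps_to_def dims)
  show "j = j'" if "maps_to P i j" "maps_to P i j'" for i j j'
  proof -
    have "card {j. j < n \<and> P $$ (i, j) = 1} \<le> Suc 0"
      using assms that by (auto simp: partial_perms_def maps_to_def)
    then show ?thesis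
      using that by (subst (asm) card_le_Suc0_iff_eq) (auto simp: maps_to_def dims)
  qed
  show "i = i'" if "maps_to P i j" "maps_to P i' j" for i i' j
  proof -
    have "card {i. i < n \<and> P $$ (i, j) = 1} \<le> Suc 0"
      using assms that by (auto simp: partial_perms_def maps_to_def)
    then show ?thesis
      using that by (subst (asm) card_le_Suc0_iff_eq) (auto simp: maps_to_def dims)
  qed
qed simp

lemma not_maps_to_iff:
  assumes "P \<in> partial_perms n k" and "i < n" and "j < n"
  shows "\<not> maps_to P i j \<longleftrightarrow> P $$ (i, j) = 0"
proof -
  have "P $$ (i, j) \<in> {0, 1}" "dim_row P = n" "dim_col P = n"
    using assms unfolding partial_perms_def by blast+
  then show ?thesis using assms(2,3) by (auto simp: maps_to_def)
qed

lemma row_eq_0_iff: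
  assumes P: "P \<in> partial_perms n k" and "i < n"
  shows "row P i = 0\<^sub>v n \<longleftrightarrow> (\<forall>j. \<not> maps_to P i j)"
proof -
  have dims: "dim_row P = n" "dim_col P = n" using P by (auto simp: partial_perms_def)
  have "row P i = 0\<^sub>v n \<longleftrightarrow> (\<forall>j<n. P $$ (i, j) = 0)"
    using \<open>i < n\<close> by (simp add: vec_eq_iff dims)
  also have "\<dots> \<longleftrightarrow> (\<forall>j<n. \<not> maps_to P i j)"
    using not_maps_to_iff[OF P \<open>i < n\<close>] by simp
  finally show ?thesis by (auto simp: maps_to_def dims)
qed

lemma col_eq_0_iff:
  assumes P: "P \<in> partial_perms n k" and "j < n"
  shows "col P j = 0\<^sub>v n \<longleftrightarrow> (\<forall>i. \<not> maps_to P i j)"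
proof -
  have dims: "dim_row P = n" "dim_col P = n" using P by (auto simp: partial_perms_def)
  have "col P j = 0\<^sub>v n \<longleftrightarrow> (\<forall>i<n. P $$ (i, j) = 0)"
    using \<open>j < n\<close> by (simp add: vec_eq_iff dims)
  also have "\<dots> \<longleftrightarrow> (\<forall>i<n. \<not> maps_to P i j)"
    using not_maps_to_iff[OF P _ \<open>j < n\<close>] by simp
  finally show ?thesis by (auto simp: maps_to_def dims)
qed

text \<open>The cycle words of a matrix carry no explicit range condition: every letter with a
  successor is in range through \<open>maps_to\<close>, so only the last one is checked
  separately.\<close>

lemma set_subset_if_chain:
  assumes "w \<noteq> []" and "\<And>l. Suc l < length w \<Longrightarrow> w ! l \<in> V" and "last w \<in> V"
  shows "set w \<subseteq> V"
proof
  fix x assume "x \<in> set w"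
  then obtain l where l: "l < length w" "x = w ! l" by (auto simp: in_set_conv_nth)
  show "x \<in> V"
  proof (cases "Suc l < length w")
    case False
    then have "l = length w - 1" using l by simp
    then show ?thesis using assms(1,3) l by (simp add: last_conv_nth)
  qed (use assms l in auto)
qed

lemma blocks_of_maps_to:
  assumes P: "P \<in> partial_perms n k"
  shows "blocks_of {..<n} (maps_to P) = Pair True ` full_cycles P \<union> Pair False ` partial_cycles P"
proof -
  have dims: "dim_row P = n" "dim_col P = n" using P by (auto simp: partial_perms_def)
  interpret partial_injection "{..<n}" "maps_to P" by (rule partial_injection_maps_to[OF P])
  have "(True, w) \<in> blocks_of {..<n} (maps_to P) \<longleftrightarrow> w \<in> full_cycles P" for w
    using rel_in set_subset_if_chain[of w "{..<n}"]
    by (auto simp: blocks_of_def word_blocks_def full_cycles_def)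
  moreover have "(False, w) \<in> blocks_of {..<n} (maps_to P) \<longleftrightarrow> w \<in> partial_cycles P" for w
  proof
    assume "(False, w) \<in> blocks_of {..<n} (maps_to P)"
    then have w: "w \<noteq> []" "distinct w" "set w \<subseteq> {..<n}"
        "\<forall>l. Suc l < length w \<longrightarrow> maps_to P (w ! l) (w ! Suc l)"
        "\<forall>x. \<not> maps_to P x (hd w)" "\<forall>y. \<not> maps_to P (last w) y"
      using rel_in by (auto simp: blocks_of_def word_blocks_def)
    moreover have "hd w < n" "last w < n" using w(1,3) by (auto simp: subset_iff)
    ultimately show "w \<in> partial_cycles P"
      using row_eq_0_iff[OF P] col_eq_0_iff[OF P] by (simp add: partial_cycles_def dims)
  next
    assume "w \<in> partial_cycles P"
    then have w: "w \<noteq> []" "distinct w"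
        "\<forall>l. Suc l < length w \<longrightarrow> maps_to P (w ! l) (w ! Suc l)"
        "\<forall>x. \<not> maps_to P x (hd w)" "\<forall>y. \<not> maps_to P (last w) y" "last w < n"
      using row_eq_0_iff[OF P] col_eq_0_iff[OF P] by (auto simp: partial_cycles_def dims)
    moreover have "set w \<subseteq> {..<n}"
      using w rel_in by (intro set_subset_if_chain) auto
    ultimately show "(False, w) \<in> blocks_of {..<n} (maps_to P)"
      by (simp add: blocks_of_def word_blocks_def)
  qed
  ultimately show ?thesis by (auto simp: image_iff) (metis (full_types))+
qed

lemma card_partial_blocks:
  assumes P: "P \<in> partial_perms n k"
  shows "card {\<beta> \<in> blocks_of {..<n} (maps_to P). \<not> fst \<beta>} = k"
proof -
  interpret partial_injection "{..<n}" "maps_to P" by (rule partial_injection_maps_to[OF P])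
  have "{i \<in> {..<n}. \<forall>j. \<not> maps_to P i j} = {i. i < n \<and> row P i = 0\<^sub>v n}"
    using row_eq_0_iff[OF P] by auto
  then show ?thesis
    using P bij_betw_same_card[OF bij_betw_last_blocks_of] by (simp add: partial_perms_def)
qed

definition relation_mat :: "nat \<Rightarrow> (nat \<Rightarrow> nat \<Rightarrow> bool) \<Rightarrow> nat mat" where
  "relation_mat n r = mat n n (\<lambda>(i, j). if r i j then 1 else 0)"

lemma maps_to_relation_mat:
  "partial_injection {..<n} r \<Longrightarrow> maps_to (relation_mat n r) = r"
  by (auto simp: fun_eq_iff maps_to_def relation_mat_def dest: partial_injection.rel_in)

lemma relation_mat_maps_to:
  assumes P: "P \<in> partial_perms n k"
  shows "relation_mat n (maps_to P) = P"
proof (rule eq_matI)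
  have dims: "dim_row P = n" "dim_col P = n" using P by (auto simp: partial_perms_def)
  then show "dim_row (relation_mat n (maps_to P)) = dim_row P"
    "dim_col (relation_mat n (maps_to P)) = dim_col P"
    by (simp_all add: relation_mat_def)
  fix i j assume "i < dim_row P" "j < dim_col P"
  then show "relation_mat n (maps_to P) $$ (i, j) = P $$ (i, j)"
    using not_maps_to_iff[OF P, of i j] by (auto simp: relation_mat_def maps_to_def dims)
qed

text \<open>The number of zero rows stays open; it is found afterwards by counting partial
  blocks.\<close>

lemma relation_mat_in_partial_perms:
  assumes "partial_injection {..<n} r"
  shows "\<exists>k. relation_mat n r \<in> partial_perms n k"
proof -
  interpret partial_injection "{..<n}" r by fact
  have entry: "relation_mat n r $$ (i, j) = 1 \<longleftrightarrow> r i j" if "i < n" "j < n" for i j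
    using that by (simp add: relation_mat_def)
  have "card {j. j < n \<and> relation_mat n r $$ (i, j) = 1} \<le> 1" if "i < n" for i
  proof -
    have "{j. j < n \<and> relation_mat n r $$ (i, j) = 1} = {j. j < n \<and> r i j}"
      using entry that by auto
    moreover have "x = y" if "x \<in> {j. j < n \<and> r i j}" "y \<in> {j. j < n \<and> r i j}" for x y
      using that rel_right_unique by blast
    then have "card {j. j < n \<and> r i j} \<le> Suc 0"
      by (subst card_le_Suc0_iff_eq) simp_all
    ultimately show ?thesis by simp
  qed
  moreover have "card {i. i < n \<and> relation_mat n r $$ (i, j) = 1} \<le> 1" if "j < n" for j
  proof -
    have "{i. i < n \<and> relation_mat n r $$ (i, j) = 1} = {i. i < n \<and> r i j}"
      using entry that by auto
    moreover have "x = y" if "x \<in> {i. i < n \<and> r i j}" "y \<in> {i. i < n \<and> r i j}" for x y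
      using that rel_left_unique by blast
    then have "card {i. i < n \<and> r i j} \<le> Suc 0"
      by (subst card_le_Suc0_iff_eq) simp_all
    ultimately show ?thesis by simp
  qed
  moreover have "relation_mat n r \<in> carrier_mat n n"
    "\<forall>i<n. \<forall>j<n. relation_mat n r $$ (i, j) \<in> {0, 1}"
    by (simp_all add: relation_mat_def)
  ultimately show ?thesis unfolding partial_perms_def by blast
qed

lemma bij_betw_blocks_of:
  "bij_betw (\<lambda>P. blocks_of {..<n} (maps_to P)) (partial_perms n k)
    {C \<in> decomps block_support word_blocks {..<n}. card {\<beta> \<in> C. \<not> fst \<beta>} = k}"
proof (rule bij_betw_byWitness[where f' = "\<lambda>C. relation_mat n (\<lambda>i j. \<exists>\<beta>\<in>C. linked \<beta> i j)"])
  show "\<forall>P\<in>partial_perms n k. relation_mat n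
      (\<lambda>i j. \<exists>\<beta>\<in>blocks_of {..<n} (maps_to P). linked \<beta> i j) = P"
    using partial_injection.ex_linked_blocks_of_iff[OF partial_injection_maps_to]
    by (simp add: relation_mat_maps_to)
  show "(\<lambda>P. blocks_of {..<n} (maps_to P)) ` partial_perms n k \<subseteq>
      {C \<in> decomps block_support word_blocks {..<n}. card {\<beta> \<in> C. \<not> fst \<beta>} = k}"
    using partial_injection.blocks_of_decomp[OF partial_injection_maps_to] card_partial_blocks
    by auto
  show *: "\<forall>C\<in>{C \<in> decomps block_support word_blocks {..<n}. card {\<beta> \<in> C. \<not> fst \<beta>} = k}.
      blocks_of {..<n} (maps_to (relation_mat n (\<lambda>i j. \<exists>\<beta>\<in>C. linked \<beta> i j))) = C"
    by (simp add: maps_to_relation_mat partial_injection_linked blocks_of_linked)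
  show "(\<lambda>C. relation_mat n (\<lambda>i j. \<exists>\<beta>\<in>C. linked \<beta> i j)) `
      {C \<in> decomps block_support word_blocks {..<n}. card {\<beta> \<in> C. \<not> fst \<beta>} = k} \<subseteq> partial_perms n k"
  proof (rule image_subsetI)
    fix C assume C: "C \<in> {C \<in> decomps block_support word_blocks {..<n}. card {\<beta> \<in> C. \<not> fst \<beta>} = k}"
    let ?P = "relation_mat n (\<lambda>i j. \<exists>\<beta>\<in>C. linked \<beta> i j)"
    have "partial_injection {..<n} (\<lambda>i j. \<exists>\<beta>\<in>C. linked \<beta> i j)"
      using C by (intro partial_injection_linked) auto
    then obtain k' where k': "?P \<in> partial_perms n k'"
      using relation_mat_in_partial_perms by blast
    have "blocks_of {..<n} (maps_to ?P) = C" using *[rule_format, OF C] .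
    then have "k' = k" using card_partial_blocks[OF k'] C by simp
    then show "?P \<in> partial_perms n k" using k' by simp
  qed
qed

section \<open>Generating functions\<close>

definition up_down_blocks :: "(bool \<times> nat list) set" where
  "up_down_blocks = {\<beta> \<in> word_blocks. up_down (snd \<beta>)}"

definition block_weight :: "bool \<times> nat list \<Rightarrow> rat poly poly" where
  "block_weight \<beta> = (if fst \<beta> then if length (snd \<beta>) = 1 then q_var else t_var else 1)"

text \<open>The additional outermost variable marks partial cycles, so that the number
  \<open>k\<close> becomes a degree and one weighted sum serves all \<open>k\<close>.\<close>

definition block_monom :: "bool \<times> nat list \<Rightarrow> rat poly poly poly" where
  "block_monom \<beta> = monom (block_weight \<beta>) (if fst \<beta> then 0 else 1)"

lemma prod_block_monom:
  "finite C \<Longrightarrow> (\<Prod>\<beta>\<in>C. block_monom \<beta>) =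
    monom (\<Prod>\<beta>\<in>C. block_weight \<beta>) (card {\<beta> \<in> C. \<not> fst \<beta>})"
proof (induction C rule: finite_induct)
  case (insert \<beta> C)
  have "card {\<beta>' \<in> insert \<beta> C. \<not> fst \<beta>'} = (if fst \<beta> then 0 else 1) + card {\<beta> \<in> C. \<not> fst \<beta>}"
  proof (cases "fst \<beta>")
    case True
    then have "{\<beta>' \<in> insert \<beta> C. \<not> fst \<beta>'} = {\<beta> \<in> C. \<not> fst \<beta>}" by auto
    then show ?thesis using True by simp
  next
    case False
    then have "{\<beta>' \<in> insert \<beta> C. \<not> fst \<beta>'} = insert \<beta> {\<beta> \<in> C. \<not> fst \<beta>}" by auto
    then show ?thesis using False insert.hyps by simp
  qed
  then show ?case using insert by (simp add: block_monom_def mult_monom)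
qed simp

lemma alternating_Cons_minimum:
  assumes "\<And>x. x \<in> set w \<Longrightarrow> m < (x :: nat)"
  shows "alternating (<) (m # w) \<longleftrightarrow> alternating (>) w"
  using assms by (cases w) auto

text \<open>The step after a leading minimum is always an ascent; deleting the minimum leaves a
  down-up word on one letter fewer, and orientation does not affect the count.\<close>

lemma card_up_down_min_first:
  fixes S :: "nat set"
  assumes "finite S" and "S \<noteq> {}"
  shows "card {w \<in> permutations_of_set S. hd w = Min S \<and> alternating (<) w} = zigzag (card S - 1)"
proof -
  let ?m = "Min S"
  have m: "?m \<in> S" "\<And>x. x \<in> S - {?m} \<Longrightarrow> ?m < x"
    using assms by (auto simp: less_le)
  have "{w \<in> permutations_of_set S. hd w = ?m \<and> alternating (<) w} =
      (#) ?m ` {w \<in> permutations_of_set (S - {?m}). alternating (>) w}"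
  proof (intro equalityI subsetI)
    fix w assume w: "w \<in> {w \<in> permutations_of_set S. hd w = ?m \<and> alternating (<) w}"
    then obtain w' where w': "w = ?m # w'"
      using m(1) by (cases w) (auto simp: permutations_of_set_def)
    then have "set w' = S - {?m}" "distinct w'"
      using w by (auto simp: permutations_of_set_def)
    then show "w \<in> (#) ?m ` {w \<in> permutations_of_set (S - {?m}). alternating (>) w}"
      using w alternating_Cons_minimum[of w' ?m] m(2) by (auto simp: w' permutations_of_set_def)
  next
    fix w assume "w \<in> (#) ?m ` {w \<in> permutations_of_set (S - {?m}). alternating (>) w}"
    then obtain w' where w': "w = ?m # w'" "set w' = S - {?m}" "distinct w'" "alternating (>) w'"
      by (auto simp: permutations_of_set_def)
    then have "set w = S" "distinct w" using m(1) by auto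
    then show "w \<in> {w \<in> permutations_of_set S. hd w = ?m \<and> alternating (<) w}"
      using w' alternating_Cons_minimum[of w' ?m] m(2) by (simp add: permutations_of_set_def)
  qed
  then have "card {w \<in> permutations_of_set S. hd w = ?m \<and> alternating (<) w} =
      alt_count (>) (S - {?m})"
    by (simp add: card_image alt_count_def)
  also have "\<dots> = zigzag (card S - 1)"
    using assms m(1) by (simp add: alt_count_eq_zigzag)
  finally show ?thesis .
qed

text \<open>Linear in the marker: the constant coefficient collects full cycles, the other one
  partial cycles. Only positive \<open>j\<close> is meaningful.\<close>

definition block_gf :: "nat \<Rightarrow> rat poly poly poly" where
  "block_gf j = [:of_nat (zigzag (j - 1)) * (if j = 1 then q_var else t_var), of_nat (zigzag j):]"

lemma sum_block_monom:
  assumes "finite S" and "S \<noteq> {}"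
  shows "(\<Sum>\<beta> | \<beta> \<in> up_down_blocks \<and> block_support \<beta> = S. block_monom \<beta>) = block_gf (card S)"
proof -
  let ?U = "{w \<in> permutations_of_set S. alternating (<) w}"
  let ?F = "{w \<in> permutations_of_set S. hd w = Min S \<and> alternating (<) w}"
  have len: "length w = card S" if "w \<in> permutations_of_set S" for w
    using that by (auto simp: permutations_of_set_def distinct_card)
  have "{\<beta>. \<beta> \<in> up_down_blocks \<and> block_support \<beta> = S} = Pair True ` ?F \<union> Pair False ` ?U"
    using assms(2)
    by (auto simp: up_down_blocks_def word_blocks_def up_down_eq_alternating permutations_of_set_def)
  then have "(\<Sum>\<beta> | \<beta> \<in> up_down_blocks \<and> block_support \<beta> = S. block_monom \<beta>) =
      (\<Sum>\<beta>\<in>Pair True ` ?F. block_monom \<beta>) + (\<Sum>\<beta>\<in>Pair False ` ?U. block_monom \<beta>)"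
    by (simp only:) (intro sum.union_disjoint, auto)
  also have "(\<Sum>\<beta>\<in>Pair True ` ?F. block_monom \<beta>) =
      (\<Sum>w\<in>?F. monom (if card S = 1 then q_var else t_var) 0)"
    by (subst sum.reindex) (auto simp: inj_on_def block_monom_def block_weight_def len intro!: sum.cong)
  also have "\<dots> = of_nat (zigzag (card S - 1)) * monom (if card S = 1 then q_var else t_var) 0"
    using card_up_down_min_first[OF assms] by simp
  also have "(\<Sum>\<beta>\<in>Pair False ` ?U. block_monom \<beta>) = (\<Sum>w\<in>?U. monom 1 1)"
    by (subst sum.reindex) (auto simp: inj_on_def block_monom_def block_weight_def intro!: sum.cong)
  also have "\<dots> = of_nat (zigzag (card S)) * monom 1 1"
    using alt_count_eq_zigzag[OF assms(1), of "(<)"] by (simp add: alt_count_def)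
  finally show ?thesis by (simp add: block_gf_def of_nat_poly monom_Suc monom_0)
qed

interpretation up_down: block_structure block_support up_down_blocks
proof
  show "block_support \<beta> \<noteq> {}" if "\<beta> \<in> up_down_blocks" for \<beta>
    using that by (auto simp: up_down_blocks_def word_blocks_def)
  show "finite {\<beta> \<in> up_down_blocks. block_support \<beta> = S}" if "finite S" for S
  proof (rule finite_subset)
    show "{\<beta> \<in> up_down_blocks. block_support \<beta> = S} \<subseteq> UNIV \<times> permutations_of_set S"
      by (auto simp: up_down_blocks_def word_blocks_def permutations_of_set_def)
  qed simp
qed

section \<open>The generating function of all decompositions\<close>

definition decomp_gf :: "nat \<Rightarrow> rat poly poly poly" where
  "decomp_gf n = (\<Sum>C\<in>decomps block_support up_down_blocks {..<n}. \<Prod>\<beta>\<in>C. block_monom \<beta>)"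

lemma decomp_gf_0: "decomp_gf 0 = 1"
  by (simp add: decomp_gf_def up_down.decomps_empty)

lemma decomp_gf_Suc:
  "decomp_gf (Suc n) = (\<Sum>j\<le>n. of_nat (n choose j) * (block_gf (Suc j) * decomp_gf (n - j)))"
  unfolding decomp_gf_def
  by (rule up_down.sum_decomps_lessThan_Suc) (rule sum_block_monom)

lemma coeff_decomp_gf: "coeff (decomp_gf n) k = catalan_matrix s_seed t_seed n k"
proof (rule catalan_matrix_eqI[where E = "\<lambda>n. of_nat (zigzag n)"])
  show "of_nat (zigzag 0) = (1 :: rat poly poly)" by simp
  show "2 * of_nat (zigzag (Suc n)) = ((if n = 0 then 1 else 0) +
      (\<Sum>j\<le>n. of_nat (n choose j) * (of_nat (zigzag j) * of_nat (zigzag (n - j)))) :: rat poly poly)"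
    for n :: nat
  proof -
    have "of_nat (2 * zigzag (Suc n)) = (of_nat ((if n = 0 then 1 else 0) +
        (\<Sum>j\<le>n. (n choose j) * (zigzag j * zigzag (n - j)))) :: rat poly poly)"
      by (simp only: double_zigzag_Suc)
    then show ?thesis by simp
  qed
  show "coeff (decomp_gf 0) k = (if k = 0 then 1 else 0)" for k
    by (cases k) (simp_all add: decomp_gf_0 one_pCons)
  \<comment> \<open>A factor linear in the marker involves only the coefficients \<open>k\<close>
    and \<open>k - 1\<close> of the other factor. For \<open>j = 0\<close> the count
    \<open>zigzag 0\<close> is 1.\<close>
  show "coeff (decomp_gf (Suc n)) k = (\<Sum>j\<le>n. of_nat (n choose j) *
      ((if j = 0 then q_var else t_var * of_nat (zigzag j)) * coeff (decomp_gf (n - j)) k +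
       (if k = 0 then 0 else of_nat (zigzag (Suc j)) * coeff (decomp_gf (n - j)) (k - 1))))" for n k
    unfolding decomp_gf_Suc coeff_sum
    by (intro sum.cong refl, cases k) (simp_all add: block_gf_def of_nat_poly coeff_pCons algebra_simps)
qed

section \<open>Transfer of the weighted count to matrices\<close>

lemma bij_betw_up_down_decomps:
  "bij_betw (\<lambda>P. blocks_of {..<n} (maps_to P)) (cycle_up_down n k)
    {C \<in> decomps block_support up_down_blocks {..<n}. card {\<beta> \<in> C. \<not> fst \<beta>} = k}"
proof -
  have "P \<in> cycle_up_down n k \<longleftrightarrow>
      P \<in> partial_perms n k \<and> (\<forall>\<beta>\<in>blocks_of {..<n} (maps_to P). up_down (snd \<beta>))" for P
    by (auto simp: cycle_up_down_def blocks_of_maps_to ball_Un)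
  then have ud: "cycle_up_down n k =
      {P \<in> partial_perms n k. \<forall>\<beta>\<in>blocks_of {..<n} (maps_to P). up_down (snd \<beta>)}"
    by blast
  have decomps: "{C \<in> decomps block_support up_down_blocks {..<n}. card {\<beta> \<in> C. \<not> fst \<beta>} = k} =
      {C \<in> {C \<in> decomps block_support word_blocks {..<n}. card {\<beta> \<in> C. \<not> fst \<beta>} = k}.
        \<forall>\<beta>\<in>C. up_down (snd \<beta>)}"
    unfolding decomps_def up_down_blocks_def by blast
  \<comment> \<open>Being up-down is a condition on the image \<open>f a\<close> alone, so the
    bijection for all partial permutations restricts.\<close>
  have "bij_betw f {a \<in> A. Q (f a)} {b \<in> B. Q b}" if "bij_betw f A B" for f A B Q
    using that by (auto simp: bij_betw_def inj_on_def)
  from this[OF bij_betw_blocks_of[of n k], of "\<lambda>C. \<forall>\<beta>\<in>C. up_down (snd \<beta>)"]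
  show ?thesis unfolding ud decomps .
qed

lemma prod_block_weight:
  assumes P: "P \<in> partial_perms n k"
  shows "(\<Prod>\<beta>\<in>blocks_of {..<n} (maps_to P). block_weight \<beta>) =
    q_var ^ fix_count P * t_var ^ cyc_ge2 P"
proof -
  interpret partial_injection "{..<n}" "maps_to P" by (rule partial_injection_maps_to[OF P])
  have dims: "dim_row P = n" "dim_col P = n" using P by (auto simp: partial_perms_def)
  have "finite (blocks_of {..<n} (maps_to P))"
  proof (rule finite_subset)
    show "blocks_of {..<n} (maps_to P) \<subseteq> UNIV \<times> (\<Union>S\<in>Pow {..<n}. permutations_of_set S)"
      by (auto simp: blocks_of_def word_blocks_def permutations_of_set_def)
  qed auto
  then have fin: "finite (full_cycles P)" "finite (partial_cycles P)"
    by (auto simp: blocks_of_maps_to[OF P] inj_on_def dest!: finite_imageD)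
  have "(\<Prod>\<beta>\<in>blocks_of {..<n} (maps_to P). block_weight \<beta>) =
      (\<Prod>\<beta>\<in>Pair True ` full_cycles P. block_weight \<beta>) *
      (\<Prod>\<beta>\<in>Pair False ` partial_cycles P. block_weight \<beta>)"
    unfolding blocks_of_maps_to[OF P] using fin by (intro prod.union_disjoint) auto
  also have "(\<Prod>\<beta>\<in>Pair False ` partial_cycles P. block_weight \<beta>) = 1"
    by (intro prod.neutral) (auto simp: block_weight_def)
  also have "(\<Prod>\<beta>\<in>Pair True ` full_cycles P. block_weight \<beta>) =
      (\<Prod>w\<in>full_cycles P. if length w = 1 then q_var else t_var)"
    by (subst prod.reindex) (auto simp: inj_on_def block_weight_def intro!: prod.cong)
  also have "\<dots> = q_var ^ card {w \<in> full_cycles P. length w = 1} *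
      t_var ^ card {w \<in> full_cycles P. length w \<noteq> 1}"
    using fin by (simp add: prod.If_cases Int_def)
  \<comment> \<open>In a one-letter word the closing link is a diagonal entry.\<close>
  also have "{w \<in> full_cycles P. length w = 1} = (\<lambda>i. [i]) ` {i. i < dim_row P \<and> P $$ (i, i) = 1}"
    by (auto simp: full_cycles_def maps_to_def dims length_Suc_conv image_iff)
  also have "card \<dots> = fix_count P"
    unfolding fix_count_def by (intro card_image) (simp add: inj_on_def)
  also have "{w \<in> full_cycles P. length w \<noteq> 1} = {w \<in> full_cycles P. length w \<ge> 2}"
  proof -
    have "length w \<noteq> 1 \<longleftrightarrow> length w \<ge> 2" if "w \<in> full_cycles P" for w
      using that by (cases "length w") (auto simp: full_cycles_def)
    then show ?thesis by blast
  qed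
  finally show ?thesis by (simp add: cyc_ge2_def)
qed

theorem theorem7p2:
  fixes n k :: nat
  shows "catalan_matrix s_seed t_seed n k =
    (\<Sum>P\<in>cycle_up_down n k. q_var ^ fix_count P * t_var ^ cyc_ge2 P)"
proof -
  let ?D = "decomps block_support up_down_blocks {..<n}"
  \<comment> \<open>The product is a single monomial whose degree counts partial cycles, so the
    coefficient selects the decompositions with exactly \<open>k\<close> of them.\<close>
  have "coeff (\<Prod>\<beta>\<in>C. block_monom \<beta>) k =
      (if card {\<beta> \<in> C. \<not> fst \<beta>} = k then \<Prod>\<beta>\<in>C. block_weight \<beta> else 0)" if "C \<in> ?D" for C
    using up_down.finite_decomp[OF _ that] by (simp add: prod_block_monom)
  then have "coeff (decomp_gf n) k =
      (\<Sum>C\<in>?D. if card {\<beta> \<in> C. \<not> fst \<beta>} = k then \<Prod>\<beta>\<in>C. block_weight \<beta> else 0)"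
    unfolding decomp_gf_def coeff_sum by (intro sum.cong) auto
  also have "\<dots> = (\<Sum>C | C \<in> ?D \<and> card {\<beta> \<in> C. \<not> fst \<beta>} = k. \<Prod>\<beta>\<in>C. block_weight \<beta>)"
    by (simp add: sum.inter_filter[symmetric] up_down.finite_decomps)
  also have "\<dots> = (\<Sum>P\<in>cycle_up_down n k. \<Prod>\<beta>\<in>blocks_of {..<n} (maps_to P). block_weight \<beta>)"
    using sum.reindex_bij_betw[OF bij_betw_up_down_decomps[of n k],
        of "\<lambda>C. \<Prod>\<beta>\<in>C. block_weight \<beta>"] by simp
  also have "\<dots> = (\<Sum>P\<in>cycle_up_down n k. q_var ^ fix_count P * t_var ^ cyc_ge2 P)"
    by (intro sum.cong refl prod_block_weight) (auto simp: cycle_up_down_def)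
  finally show ?thesis by (simp add: coeff_decomp_gf)
qed

end
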